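(* Let $u_0\in H^s$, $s>\frac52$, be a spatially periodic divergence-free vector field, and let $T>0$ and $M_1$ be fixed such that, for every $\Omega>0$, the spatially periodic solution $u=u^{\Omega}$ of $$\partial_t u + u\cdot\nabla u + \nabla\pi + 2\Omega\, e_3\times u = 0,\qquad \nabla\cdot u = 0,\qquad u(\cdot,0)=u_0,$$ exists on $[0,T]$ and obeys $\sup_{0\le t\le T}\|\nabla u(\cdot,t)\|_{L^\infty(dx)}\le M_1$, and such that $M_1T\le\log\frac54$. For each $\Omega$ satisfying $\Omega\ge 4M_1$, consider the inverse and direct Lagrangian displacements $$\ell(x,y,z,t)=A(x,y,z,t)-(x,y,z),\qquad \lambda(a_1,a_2,a_3,t)=X(a_1,a_2,a_3,t)-(a_1,a_2,a_3).$$ They obey, for $t\in[0,T]$, $$\|\partial_z\ell(\cdot,t)\|_{L^\infty(dx)}\le14\rho\qquad\text{and}\qquad\|\partial_{a_3}\lambda(\cdot,t)\|_{L^\infty(da)}\le 9\rho,$$ with $\rho=\Omega^{-1}\sup_{0\le t\le T}\|\nabla\times u(\cdot,t)\|_{L^\infty(dx)}\le\Omega^{-1}M_1$. Let $\Omega_j\to\infty$ be an arbitrary sequence and let $X^{j}(a_1,a_2,a_3,t)$ denote the Lagrangian paths associated to $\Omega_j$. Then there exist a subsequence (still denoted by $j$), an invertible map $X(a_1,a_2,a_3,t)$, and a periodic function of two variables $\lambda(a_1,a_2,t)$ (with values in $\mathbb R^3$) such that $$\lim_{j\to\infty}X^{j}(a_1,a_2,a_3,t)=X(a_1,a_2,a_3,t)$$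 holds uniformly in $a$, $t$, and $$X(a_1,a_2,a_3,t)=(a_1,a_2,a_3)+\lambda(a_1,a_2,t).$$
   Context: $\Omega>0$ is a constant and $e_3$ is the unit vector of the third Cartesian direction (the rotation axis). Spatially periodic means $u(x+L_1,y+L_2,z+L_3,t)=u(x,y,z,t)$ for fixed periods $L_1,L_2,L_3>0$. $H^s$ is the space of divergence-free, periodic, square integrable vector fields having $s$ square integrable derivatives. The Lagrangian map $X(a,t)$ associated to $u=u^{\Omega}$ solves $\partial_tX(a,t)=u(X(a,t),t)$, $X(a,0)=a$; $A(\cdot,t)=X(\cdot,t)^{-1}$ is the inverse map. "Invertible" means that $a\mapsto X(a,t)$ is invertible for each $t\in[0,T]$; "periodic" for $\lambda(a_1,a_2,t)$ means with periods $L_1$, $L_2$ in $a_1$, $a_2$. $\|\nabla u\|_{L^\infty}$ is the supremum over $x$ of $|\nabla u(x,t)|$, where $|\cdot|$ is a fixed submultiplicative norm on $3\times3$ matrices which dominates the Euclidean operator norm and satisfies $|\nabla\times u|\le|\nabla u|$ pointwise. *)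

theory Defs
  imports "HOL-Analysis.Analysis"
begin

abbreviation e3 :: "real^3"
  where "e3 \<equiv> axis 3 1"

definition spatially_periodic :: "real^3 \<Rightarrow> (real^3 \<Rightarrow> 'b) \<Rightarrow> bool"
  where "spatially_periodic L f \<longleftrightarrow> (\<forall>i x. f (x + (L $ i) *\<^sub>R axis i 1) = f x)"

text \<open>The library's \<open>jacobian f (at x)\<close> has entry \<open>\<partial>\<^sub>j f\<^sub>i\<close> in row \<open>i\<close> and column \<open>j\<close>;
  it is the matrix \<open>\<nabla>f\<close>, and \<open>f \<cdot> \<nabla>f\<close> is \<open>jacobian f (at x) *v f x\<close>.\<close>

definition gradient :: "(real^3 \<Rightarrow> real) \<Rightarrow> real^3 \<Rightarrow> real^3"
  where "gradient p x = (\<chi> i. frechet_derivative p (at x) (axis i 1))"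

definition divergence :: "(real^3 \<Rightarrow> real^3) \<Rightarrow> real^3 \<Rightarrow> real"
  where "divergence v x = trace (jacobian v (at x))"

definition curl :: "(real^3 \<Rightarrow> real^3) \<Rightarrow> real^3 \<Rightarrow> real^3"
  where "curl v x = (let J = jacobian v (at x) in
    vector [J $ 3 $ 2 - J $ 2 $ 3, J $ 1 $ 3 - J $ 3 $ 1, J $ 2 $ 1 - J $ 1 $ 2])"

definition has_partial3 :: "(real^3 \<Rightarrow> real^3) \<Rightarrow> real^3 \<Rightarrow> bool"
  where "has_partial3 f x \<longleftrightarrow> (\<lambda>h. f (x + h *\<^sub>R e3)) differentiable (at 0)"

definition partial3 :: "(real^3 \<Rightarrow> real^3) \<Rightarrow> real^3 \<Rightarrow> real^3"
  where "partial3 f x = vector_derivative (\<lambda>h. f (x + h *\<^sub>R e3)) (at 0)"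

text \<open>Suprema are taken in \<^typ>\<open>ereal\<close>, where they exist without a boundedness assumption.
  All fields concerned are continuous, so this is the \<open>L\<^sup>\<infinity>\<close> norm.\<close>

definition sup_norm :: "(real^3 \<Rightarrow> real^3) \<Rightarrow> ereal"
  where "sup_norm f = (SUP x. ereal (norm (f x)))"

definition grad_sup_norm :: "(real^3^3 \<Rightarrow> real) \<Rightarrow> (real^3 \<Rightarrow> real^3) \<Rightarrow> ereal"
  where "grad_sup_norm N v = (SUP x. ereal (N (jacobian v (at x))))"

definition admissible_matrix_norm :: "(real^3^3 \<Rightarrow> real) \<Rightarrow> bool"
  where "admissible_matrix_norm N \<longleftrightarrow>
    (\<forall>A. 0 \<le> N A) \<and> (\<forall>A. N A = 0 \<longleftrightarrow> A = 0) \<and>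
    (\<forall>c A. N (c *\<^sub>R A) = \<bar>c\<bar> * N A) \<and>
    (\<forall>A B. N (A + B) \<le> N A + N B) \<and>
    (\<forall>A B. N (A ** B) \<le> N A * N B) \<and>
    (\<forall>A. onorm ((*v) A) \<le> N A) \<and>
    (\<forall>v x. v differentiable (at x) \<longrightarrow> norm (curl v x) \<le> N (jacobian v (at x)))"

text \<open>For real \<open>s\<close>, ``\<open>s\<close> square integrable derivatives'' is expressed through the Fourier
  coefficients on the period cell. The vanishing sum over \<open>i\<close> is the \<open>k\<close>-th Fourier
  coefficient of the distribution \<open>div v\<close>, up to the factor \<open>\<i>\<close>.\<close>

definition wave_vector :: "real^3 \<Rightarrow> int^3 \<Rightarrow> real^3"
  where "wave_vector L k = (\<chi> i. 2 * pi * of_int (k $ i) / L $ i)"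

definition fourier_coeff :: "real^3 \<Rightarrow> (real^3 \<Rightarrow> real^3) \<Rightarrow> int^3 \<Rightarrow> complex^3"
  where "fourier_coeff L v k = (\<chi> i.
    (LINT x:cbox 0 L|lebesgue. complex_of_real (v x $ i) * cis (- (wave_vector L k \<bullet> x)))
      / complex_of_real (\<Prod>j\<in>UNIV. L $ j))"

definition sobolev_div_free :: "real^3 \<Rightarrow> real \<Rightarrow> (real^3 \<Rightarrow> real^3) set"
  where "sobolev_div_free L s = {v.
    spatially_periodic L v \<and>
    v \<in> borel_measurable lebesgue \<and>
    set_integrable lebesgue (cbox 0 L) (\<lambda>x. (norm (v x))\<^sup>2) \<and>
    (\<lambda>k. (1 + (norm (wave_vector L k))\<^sup>2) powr s * (norm (fourier_coeff L v k))\<^sup>2)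
      summable_on UNIV \<and>
    (\<forall>k. (\<Sum>i\<in>UNIV. complex_of_real (wave_vector L k $ i) * fourier_coeff L v k $ i) = 0)}"

text \<open>One-sided at the endpoints of the time interval.\<close>

definition time_deriv :: "real \<Rightarrow> (real \<Rightarrow> real^3 \<Rightarrow> real^3) \<Rightarrow> real \<Rightarrow> real^3 \<Rightarrow> real^3"
  where "time_deriv T u t x = vector_derivative (\<lambda>\<tau>. u \<tau> x) (at t within {0..T})"

text \<open>Classical solutions: the velocity is continuously differentiable on \<open>[0,T] \<times> \<real>\<^sup>3\<close>.
  For data in \<open>H\<^sup>s\<close> with \<open>s > 5/2\<close>, the solution in \<open>C([0,T]; H\<^sup>s)\<close> is of this kind, because
  \<open>H\<^sup>s\<close> embeds in \<open>C\<^sup>1\<close> and \<open>\<partial>\<^sub>t u\<close> lies in \<open>C([0,T]; H\<^bsup>s-1\<^esup>)\<close>. The initial datum is an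
  element of \<open>H\<^sup>s\<close>, that is, it is given up to a null set.\<close>

definition rotating_euler_solution ::
  "real^3 \<Rightarrow> real \<Rightarrow> real \<Rightarrow> (real^3 \<Rightarrow> real^3) \<Rightarrow> (real \<Rightarrow> real^3 \<Rightarrow> real^3) \<Rightarrow> bool"
  where "rotating_euler_solution L T \<Omega> u0 u \<longleftrightarrow>
    (\<forall>t\<in>{0..T}. spatially_periodic L (u t)) \<and>
    (\<forall>t\<in>{0..T}. \<forall>x. u t differentiable (at x)) \<and>
    (\<forall>t\<in>{0..T}. \<forall>x. (\<lambda>\<tau>. u \<tau> x) differentiable (at t within {0..T})) \<and>
    continuous_on ({0..T} \<times> UNIV) (\<lambda>(t, x). u t x) \<and>
    continuous_on ({0..T} \<times> UNIV) (\<lambda>(t, x). jacobian (u t) (at x)) \<and>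
    continuous_on ({0..T} \<times> UNIV) (\<lambda>(t, x). time_deriv T u t x) \<and>
    (\<forall>t\<in>{0..T}. \<forall>x. divergence (u t) x = 0) \<and>
    (\<exists>p :: real \<Rightarrow> real^3 \<Rightarrow> real. \<forall>t\<in>{0..T}.
      spatially_periodic L (p t) \<and>
      (\<forall>x. p t differentiable (at x) \<and>
        time_deriv T u t x + jacobian (u t) (at x) *v u t x + gradient (p t) x
          + (2 * \<Omega>) *\<^sub>R cross3 e3 (u t x) = 0)) \<and>
    (AE x in lebesgue. u 0 x = u0 x)"

definition lagrangian_map ::
  "real \<Rightarrow> (real \<Rightarrow> real^3 \<Rightarrow> real^3) \<Rightarrow> (real \<Rightarrow> real^3 \<Rightarrow> real^3) \<Rightarrow> bool"
  where "lagrangian_map T u X \<longleftrightarrow>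
    (\<forall>a. X 0 a = a \<and>
      (\<forall>t\<in>{0..T}. ((\<lambda>\<tau>. X \<tau> a) has_vector_derivative u t (X t a)) (at t within {0..T})))"

definition inverse_displacement :: "(real \<Rightarrow> real^3 \<Rightarrow> real^3) \<Rightarrow> real \<Rightarrow> real^3 \<Rightarrow> real^3"
  where "inverse_displacement X t x = inv (X t) x - x"

definition direct_displacement :: "(real \<Rightarrow> real^3 \<Rightarrow> real^3) \<Rightarrow> real \<Rightarrow> real^3 \<Rightarrow> real^3"
  where "direct_displacement X t a = X t a - a"

definition rossby :: "real \<Rightarrow> real \<Rightarrow> (real \<Rightarrow> real^3 \<Rightarrow> real^3) \<Rightarrow> ereal"
  where "rossby T \<Omega> u = (SUP t\<in>{0..T}. sup_norm (curl (u t))) / ereal \<Omega>"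

end

theory Submission
  imports Defs "HOL-Complex_Analysis.Great_Picard"
begin

text \<open>
  The rotation enters through the absolute vorticity \<open>\<nabla>\<times>u + 2\<Omega> e\<^sub>3\<close>. Kelvin's circulation theorem says
  that the flow carries it along: with \<open>F = \<nabla>X(a,t)\<close> the Cauchy formula is
  \<open>F (\<nabla>\<times>u\<^sub>0(a) + 2\<Omega> e\<^sub>3) = (\<nabla>\<times>u)(X(a,t),t) + 2\<Omega> e\<^sub>3\<close>. Solving for the part proportional to \<open>\<Omega>\<close>,
  \<open>2\<Omega> (F e\<^sub>3 - e\<^sub>3) = (\<nabla>\<times>u)(X(a,t),t) - F (\<nabla>\<times>u\<^sub>0)(a)\<close>.
  The left side is \<open>2\<Omega> \<partial>\<lambda>/\<partial>a\<^sub>3\<close>, and the right side is bounded by the vorticity and by the size of \<open>F\<close>.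
  Applying \<open>F\<^sup>-\<^sup>1\<close> gives the same for \<open>\<partial>\<ell>/\<partial>z\<close>.

  Everything about the flow that this uses comes from \<open>M\<^sub>1 T \<le> log (5/4) \<le> 1/4\<close>. On so short a time interval
  the maximum of a solution of \<open>|y'| \<le> M\<^sub>1 |y|\<close> is at most \<open>4/3\<close> of its initial size, and the solution moves
  by at most a third of that size (\<open>growth_bound\<close>). The same smallness makes the Volterra operator
  of the variational equation \<open>\<partial>\<^sub>t F = \<nabla>u(X) F\<close> a contraction (\<open>linear_cocycle_exists\<close>). The flow is
  thus bi-Lipschitz with constants \<open>2/3\<close> and \<open>4/3\<close>, differentiable, and onto by invariance of domain.

  The velocity is only once continuously differentiable, so the vorticity equation cannot be derived by
  taking the curl of the momentum equation. The Weber formula serves instead: the momentum equation, integrated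
  along particle paths, shows that \<open>F\<^sup>T (u(X) + \<Omega> e\<^sub>3\<times>X) - (u\<^sub>0 + \<Omega> e\<^sub>3\<times>a)\<close> is the gradient of a function
  of \<open>a\<close> (\<open>weber_formula\<close>). Although \<open>F\<close> need not be differentiable, this gradient becomes differentiable
  at a point after subtraction of the gradient of a linear combination of the components of \<open>X\<close>, and the symmetry
  of the second derivative at this point is the conservation of vorticity flux (\<open>vorticity_flux_conserved\<close>).
  With \<open>det F = 1\<close> this is the Cauchy formula (\<open>cauchy_vorticity_formula\<close>).

  For the limit of rapid rotation the paths must be equicontinuous in time, that is, \<open>u\<close> must be bounded uniformly
  in \<open>\<Omega>\<close>. The Coriolis force only rotates the spatial mean of \<open>u\<close>, and the distance from the mean is controlled by
  \<open>M\<^sub>1\<close> and the size of the period cell (\<open>velocity_bound\<close>). The theorem of Arzela and Ascoli on one period cell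
  gives a convergent subsequence; the bi-Lipschitz bounds and the periodicity survive, and since
  \<open>F e\<^sub>3 - e\<^sub>3\<close> is of order \<open>1/\<Omega>\<close>, the limit map moves vertical lines rigidly
  (\<open>subsequential_limit_of_flows\<close>).
\<close>

section \<open>Comparison, bi-Lipschitz maps and linear equations with parameters\<close>

text \<open>This replaces Gronwall's inequality. The maximum \<open>m\<close> of \<open>norm y\<close> satisfies
  \<open>m \<le> norm (y 0) + m/4 + T c\<close> by the mean value inequality, because \<open>M T \<le> 1/4\<close>, and \<open>m\<close> can be
  absorbed on the left.\<close>

lemma growth_bound:
  fixes y y' :: "real \<Rightarrow> 'a::euclidean_space"
  assumes T: "0 \<le> T" and MT: "M * T \<le> 1/4" and M: "0 \<le> M" and c: "0 \<le> c"
    and y: "\<And>t. t \<in> {0..T} \<Longrightarrow> (y has_vector_derivative y' t) (at t within {0..T})"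
    and y': "\<And>t. t \<in> {0..T} \<Longrightarrow> norm (y' t) \<le> M * norm (y t) + c"
    and t: "t \<in> {0..T}"
  shows "norm (y t) \<le> 4/3 * (norm (y 0) + T * c)"
    and "norm (y t - y 0) \<le> 1/3 * norm (y 0) + 4/3 * (T * c)"
proof -
  have "continuous_on {0..T} y"
    using y has_vector_derivative_continuous continuous_on_eq_continuous_within by blast
  then have "continuous_on {0..T} (\<lambda>t. norm (y t))"
    by (intro continuous_intros)
  then obtain \<tau> where \<tau>: "\<tau> \<in> {0..T}" and max: "\<And>t. t \<in> {0..T} \<Longrightarrow> norm (y t) \<le> norm (y \<tau>)"
    using continuous_attains_sup[of "{0..T}" "\<lambda>t. norm (y t)"] T by auto
  define m where "m = norm (y \<tau>)"
  have incr: "norm (y t - y 0) \<le> m / 4 + T * c" if t: "t \<in> {0..T}" for t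
  proof -
    have "norm (y t - y 0) \<le> (M * m + c) * norm (t - 0)"
    proof (rule differentiable_bound[of "{0..T}"])
      fix x assume x: "x \<in> {0..T}"
      show "(y has_derivative (\<lambda>h. h *\<^sub>R y' x)) (at x within {0..T})"
        using y[OF x] by (simp add: has_vector_derivative_def)
      have "norm (y' x) \<le> M * m + c"
        using y'[OF x] mult_left_mono[OF max[OF x] M] by (simp add: m_def)
      then show "onorm (\<lambda>h. h *\<^sub>R y' x) \<le> M * m + c"
        using onorm_scaleR_left[of "\<lambda>h::real. h" "y' x"]
        by (simp add: onorm_id)
    qed (use t T in auto)
    also have "\<dots> \<le> (M * m + c) * T"
      using t M c by (intro mult_left_mono) (auto simp: m_def)
    also have "\<dots> = (M * T) * m + T * c"
      by (simp add: algebra_simps)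
    also have "\<dots> \<le> m / 4 + T * c"
      using mult_right_mono[OF MT, of m] by (simp add: m_def)
    finally show ?thesis .
  qed
  have "m \<le> norm (y 0) + norm (y \<tau> - y 0)"
    unfolding m_def by (rule norm_triangle_sub)
  with incr[OF \<tau>] have m: "m \<le> 4/3 * (norm (y 0) + T * c)"
    by simp
  show "norm (y t) \<le> 4/3 * (norm (y 0) + T * c)"
    using max[OF t] m by (simp add: m_def)
  show "norm (y t - y 0) \<le> 1/3 * norm (y 0) + 4/3 * (T * c)"
    using incr[OF t] m by simp
qed

text \<open>Surjectivity without solving an equation: the range is open by invariance of domain, and closed because
  the lower bound turns convergent sequences of values into Cauchy sequences of arguments.\<close>

lemma bij_if_bilipschitz:
  fixes f :: "'a::euclidean_space \<Rightarrow> 'a"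
  assumes c: "0 < c" and cont: "continuous_on UNIV f"
    and low: "\<And>x y. c * norm (x - y) \<le> norm (f x - f y)"
  shows "bij f"
proof -
  have inj: "inj f"
  proof (rule injI)
    fix x y assume "f x = f y"
    with low[of x y] c show "x = y"
      by (simp add: mult_le_0_iff)
  qed
  have "open (range f)"
    by (rule invariance_of_domain[OF cont open_UNIV inj])
  moreover have "closed (range f)"
    unfolding closed_sequential_limits
  proof (intro allI impI, elim conjE)
    fix s l assume s: "\<forall>n. s n \<in> range f" and l: "s \<longlonglongrightarrow> l"
    have "\<forall>n. \<exists>x. s n = f x"
      using s by auto
    then obtain a where a: "\<And>n. s n = f (a n)"
      unfolding choice_iff by blast
    have "Cauchy a"
    proof (rule metric_CauchyI)
      fix e :: real assume "0 < e"
      then have "0 < c * e" using c by simp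
      then obtain K where K: "\<And>m n. m \<ge> K \<Longrightarrow> n \<ge> K \<Longrightarrow> dist (s m) (s n) < c * e"
        using metric_CauchyD[OF LIMSEQ_imp_Cauchy[OF l]] by blast
      have "dist (a m) (a n) < e" if "m \<ge> K" "n \<ge> K" for m n
      proof -
        have "c * dist (a m) (a n) \<le> dist (s m) (s n)"
          using low[of "a m" "a n"] by (simp only: a dist_norm)
        also have "\<dots> < c * e" by (rule K[OF that])
        finally show ?thesis using c by simp
      qed
      then show "\<exists>K. \<forall>m\<ge>K. \<forall>n\<ge>K. dist (a m) (a n) < e"
        by blast
    qed
    then obtain b where "a \<longlonglongrightarrow> b"
      using Cauchy_convergent convergent_def by blast
    then have "(\<lambda>n. f (a n)) \<longlonglongrightarrow> f b"
      using cont continuous_on_tendsto_compose[of UNIV f a b sequentially] by simp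
    then have "l = f b"
      using LIMSEQ_unique[OF l] by (simp flip: a)
    then show "l \<in> range f" by simp
  qed
  ultimately have "range f = UNIV"
    using clopen[of "range f"] by auto
  with inj show ?thesis by (simp add: bij_def)
qed

text \<open>The solution is the fixed point of \<open>F \<mapsto> 1 + \<integral>\<^sub>0\<^sup>t B F\<close>, a contraction with constant \<open>M T \<le> 1/4\<close>. Taking the fixed
  point among functions of time and parameter together yields joint continuity at once.\<close>

lemma linear_cocycle_exists:
  fixes B :: "real \<Rightarrow> 'p::metric_space \<Rightarrow> 'a::euclidean_space \<Rightarrow>\<^sub>L 'a"
  assumes T: "0 \<le> T" and MT: "M * T \<le> 1/4" and M: "0 \<le> M"
    and cont: "continuous_on ({0..T} \<times> UNIV) (\<lambda>(t, a). B t a)"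
    and bound: "\<And>t a. t \<in> {0..T} \<Longrightarrow> norm (B t a) \<le> M"
  obtains F :: "real \<Rightarrow> 'p \<Rightarrow> 'a \<Rightarrow>\<^sub>L 'a"
  where "continuous_on ({0..T} \<times> UNIV) (\<lambda>(t, a). F t a)"
    and "\<And>a. F 0 a = id_blinfun"
    and "\<And>t a. t \<in> {0..T} \<Longrightarrow> ((\<lambda>\<tau>. F \<tau> a) has_vector_derivative B t a o\<^sub>L F t a) (at t within {0..T})"
proof -
  \<comment> \<open>Clamping time to the interval lets the fixed point live among the bounded continuous functions on
    all of \<open>\<real> \<times> 'p\<close>.\<close>
  define cl where "cl t = max 0 (min T t)" for t :: real
  have cl: "cl t \<in> {0..T}" "0 \<le> cl t" "cl t \<le> T" for t
    using T by (auto simp: cl_def)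
  have cl_scaled: "cl t * \<sigma> \<in> {0..T}" if "\<sigma> \<in> {0..1}" for t \<sigma>
  proof -
    have "cl t * \<sigma> \<le> T * 1"
      by (intro mult_mono) (use cl that T in auto)
    then show ?thesis
      using cl[of t] that by simp
  qed
  then have cl_scaled': "0 \<le> cl t * \<sigma>" "cl t * \<sigma> \<le> T" if "0 \<le> \<sigma>" "\<sigma> \<le> 1" for t \<sigma>
    using that by auto
  have cont_cl [continuous_intros]: "continuous_on S (\<lambda>z. cl (h z))" if "continuous_on S h"
    for S :: "'z::topological_space set" and h
    unfolding cl_def by (intro continuous_intros that)
  have cont_B [continuous_intros]: "continuous_on S (\<lambda>z. B (h z) (k z))"
    if "continuous_on S h" "continuous_on S k" "\<And>z. z \<in> S \<Longrightarrow> h z \<in> {0..T}"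
    for S :: "'z::topological_space set" and h k
    using continuous_on_compose2[OF cont continuous_on_Pair[OF that(1,2)]] that(3)
    by (auto simp: image_subset_iff)
  have cont_F [continuous_intros]: "continuous_on S (\<lambda>z. apply_bcontfun F (h z, k z))"
    if "continuous_on S h" "continuous_on S k"
    for S :: "'z::topological_space set" and F :: "(real \<times> 'p) \<Rightarrow>\<^sub>C ('a \<Rightarrow>\<^sub>L 'a)" and h k
    by (rule continuous_on_compose2[OF continuous_on_apply_bcontfun[of UNIV F]
          continuous_on_Pair[OF that]]) auto
  \<comment> \<open>The integral over \<open>[0,t]\<close> is rescaled to \<open>[0,1]\<close>, so that its continuity in \<open>t\<close> and in the parameter
    is a single instance of continuous dependence on parameters.\<close>
  define G where "G F t a \<sigma> = B (cl t * \<sigma>) a o\<^sub>L apply_bcontfun F (cl t * \<sigma>, a)"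
    for F :: "(real \<times> 'p) \<Rightarrow>\<^sub>C ('a \<Rightarrow>\<^sub>L 'a)" and t a \<sigma>
  define \<Phi> where "\<Phi> F = (\<lambda>(t, a). id_blinfun + cl t *\<^sub>R integral (cbox 0 1) (G F t a))" for F
  have contG: "continuous_on (UNIV \<times> cbox 0 1) (\<lambda>(z, \<sigma>). G F (fst z) (snd z) \<sigma>)" for F
    unfolding G_def split_beta
    by (intro continuous_intros) (auto simp: cl_scaled')
  have contG1: "continuous_on {0..1} (G F t a)" for F t a
    unfolding G_def by (intro continuous_intros) (auto simp: cl_scaled')
  have cont\<Phi>: "continuous_on UNIV (\<Phi> F)" for F
    unfolding \<Phi>_def split_beta
    by (intro continuous_intros integral_continuous_on_param contG)
  have normG: "norm (G F t a \<sigma> - G H t a \<sigma>) \<le> M * dist F H" if "\<sigma> \<in> {0..1}" for F H t a \<sigma>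
  proof -
    have "G F t a \<sigma> - G H t a \<sigma> = B (cl t * \<sigma>) a o\<^sub>L (apply_bcontfun F (cl t * \<sigma>, a) - apply_bcontfun H (cl t * \<sigma>, a))"
      unfolding G_def by (simp add: blinfun_eqI blinfun.bilinear_simps)
    also have "norm \<dots> \<le> norm (B (cl t * \<sigma>) a) * dist F H"
      by (rule order_trans[OF norm_blinfun_compose])
         (use dist_bounded[of F _ H] in \<open>auto simp: dist_norm intro!: mult_left_mono\<close>)
    also have "\<dots> \<le> M * dist F H"
      using bound[OF cl_scaled[OF that]] by (intro mult_right_mono) auto
    finally show ?thesis .
  qed
  have dist\<Phi>: "norm (\<Phi> F z - \<Phi> H z) \<le> 1/4 * dist F H" for F H z
  proof -
    obtain t a where z: "z = (t, a)" by force
    have "\<Phi> F z - \<Phi> H z = cl t *\<^sub>R (integral {0..1} (G F t a) - integral {0..1} (G H t a))"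
      by (simp add: \<Phi>_def z algebra_simps)
    also have "\<dots> = cl t *\<^sub>R integral {0..1} (\<lambda>\<sigma>. G F t a \<sigma> - G H t a \<sigma>)"
      by (subst integral_diff) (auto intro: integrable_continuous_real contG1)
    also have "norm \<dots> \<le> cl t * (M * dist F H * (1 - 0))"
    proof (simp only: norm_scaleR, intro mult_mono)
      show "norm (integral {0..1} (\<lambda>\<sigma>. G F t a \<sigma> - G H t a \<sigma>)) \<le> M * dist F H * (1 - 0)"
        by (rule integral_bound) (auto intro!: continuous_intros contG1 normG)
    qed (use cl[of t] M in auto)
    also have "\<dots> \<le> T * (M * dist F H)"
      using cl[of t] M by (auto intro!: mult_right_mono)
    also have "\<dots> \<le> 1/4 * dist F H"
      using mult_right_mono[OF MT, of "dist F H"] by (simp add: algebra_simps)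
    finally show ?thesis .
  qed
  have \<Phi>0: "\<Phi> 0 = (\<lambda>_. id_blinfun)"
  proof -
    have "G 0 t a = (\<lambda>_. 0)" for t a
      unfolding G_def by (intro ext blinfun_eqI) (simp add: blinfun.bilinear_simps)
    then show ?thesis by (auto simp: \<Phi>_def)
  qed
  have bcont: "\<Phi> F \<in> bcontfun" for F
  proof (rule bcontfun_normI[OF cont\<Phi>])
    fix z
    have "norm (\<Phi> F z) \<le> norm (\<Phi> 0 z) + norm (\<Phi> F z - \<Phi> 0 z)"
      by (rule norm_triangle_sub)
    also have "\<dots> \<le> norm (id_blinfun :: 'a \<Rightarrow>\<^sub>L 'a) + 1/4 * dist F 0"
      using dist\<Phi>[of F z 0] by (simp add: \<Phi>0)
    finally show "norm (\<Phi> F z) \<le> norm (id_blinfun :: 'a \<Rightarrow>\<^sub>L 'a) + 1/4 * dist F 0" .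
  qed
  have "\<exists>!F. Bcontfun (\<Phi> F) = F"
  proof (rule banach_fix_type[of "1/4"])
    show "\<forall>F H. dist (Bcontfun (\<Phi> F)) (Bcontfun (\<Phi> H)) \<le> 1/4 * dist F H"
    proof (intro allI dist_bound)
      fix F H z
      show "dist (apply_bcontfun (Bcontfun (\<Phi> F)) z) (apply_bcontfun (Bcontfun (\<Phi> H)) z) \<le> 1/4 * dist F H"
        unfolding Bcontfun_inverse[OF bcont] dist_norm[of "\<Phi> F z"] by (rule dist\<Phi>)
    qed
  qed auto
  then obtain F0 where "Bcontfun (\<Phi> F0) = F0" by blast
  then have fix_pt: "apply_bcontfun F0 = \<Phi> F0"
    using Bcontfun_inverse[OF bcont[of F0]] by simp
  define F where "F t a = apply_bcontfun F0 (t, a)" for t a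
  show thesis
  proof (rule that[of F])
    show "continuous_on ({0..T} \<times> UNIV) (\<lambda>(t, a). F t a)"
      unfolding F_def by (simp add: split_beta)
    show "F 0 a = id_blinfun" for a
      unfolding F_def fix_pt \<Phi>_def using T by (simp add: cl_def)
    fix t a assume t: "t \<in> {0..T}"
    have contBF: "continuous_on {0..T} (\<lambda>\<tau>. B \<tau> a o\<^sub>L F \<tau> a)"
      unfolding F_def by (intro continuous_intros) auto
    have F_int: "F \<tau> a = id_blinfun + integral {0..\<tau>} (\<lambda>\<tau>. B \<tau> a o\<^sub>L F \<tau> a)" if \<tau>: "\<tau> \<in> {0..T}" for \<tau>
    proof (cases "\<tau> = 0")
      case True
      then show ?thesis unfolding F_def fix_pt \<Phi>_def using T by (simp add: cl_def)
    next
      case False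
      then have pos: "0 < \<tau>" "cl \<tau> = \<tau>" using \<tau> by (auto simp: cl_def)
      have "(\<lambda>x. x / \<tau>) ` {0..\<tau>} = {0..1}"
        using pos image_divide_atLeastAtMost[of \<tau> 0 \<tau>] by simp
      then show ?thesis
        using integral_stretch_real[of \<tau> 0 \<tau> "\<lambda>\<tau>. B \<tau> a o\<^sub>L F \<tau> a"] pos
        unfolding F_def by (subst fix_pt) (simp add: \<Phi>_def G_def[abs_def])
    qed
    have "((\<lambda>\<tau>. id_blinfun + integral {0..\<tau>} (\<lambda>\<tau>. B \<tau> a o\<^sub>L F \<tau> a)) has_vector_derivative B t a o\<^sub>L F t a) (at t within {0..T})"
      using integral_has_vector_derivative[OF contBF t] by (auto intro!: derivative_eq_intros)
    then show "((\<lambda>\<tau>. F \<tau> a) has_vector_derivative B t a o\<^sub>L F t a) (at t within {0..T})"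
      using has_vector_derivative_transform[OF t, of "\<lambda>\<tau>. F \<tau> a"] F_int by simp
  qed
qed

section \<open>Symmetry of second derivatives\<close>

text \<open>The second difference is the increment over \<open>[0,1]\<close> of
  \<open>\<sigma> \<mapsto> \<psi> (a + b + \<sigma> c) - \<psi> (a + \<sigma> c)\<close>, whose derivative differs from \<open>H b c\<close> by the error of
  the linearisation of \<open>D\<close> at two points.\<close>

lemma second_difference_estimate:
  fixes \<psi> :: "'a::real_normed_vector \<Rightarrow> real" and D :: "'a \<Rightarrow> 'a \<Rightarrow>\<^sub>L real"
  assumes \<psi>: "\<And>x. (\<psi> has_derivative D x) (at x)"
    and H: "linear H"
    and near: "\<And>x. norm (x - a) \<le> r \<Longrightarrow> norm (D x - D a - H (x - a)) \<le> \<epsilon> * norm (x - a)"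
    and bc: "norm b + norm c \<le> r" and \<epsilon>: "0 \<le> \<epsilon>"
  shows "\<bar>\<psi> (a + b + c) - \<psi> (a + b) - \<psi> (a + c) + \<psi> a - H b c\<bar> \<le> 2 * \<epsilon> * (norm b + norm c)\<^sup>2"
proof -
  define k where "k \<sigma> = \<psi> (a + b + \<sigma> *\<^sub>R c) - \<psi> (a + \<sigma> *\<^sub>R c) - \<sigma> * H b c" for \<sigma>
  define k' where "k' \<sigma> = D (a + b + \<sigma> *\<^sub>R c) c - D (a + \<sigma> *\<^sub>R c) c - H b c" for \<sigma>
  have k: "(k has_derivative (\<lambda>h. h *\<^sub>R k' \<sigma>)) (at \<sigma> within {0..1})" for \<sigma>
    unfolding k_def k'_def
    by (auto intro!: derivative_eq_intros has_derivative_compose[OF _ \<psi>]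
        simp: blinfun.bilinear_simps algebra_simps)
  have k'_bound: "\<bar>k' \<sigma>\<bar> \<le> 2 * \<epsilon> * (norm b + norm c) * norm c" if \<sigma>: "\<sigma> \<in> {0..1}" for \<sigma>
  proof -
    have \<sigma>c: "norm (\<sigma> *\<^sub>R c) \<le> norm c"
      using \<sigma> mult_right_mono[of \<sigma> 1 "norm c"] by simp
    have *: "\<bar>(D (a + z) - D a - H z) c\<bar> \<le> \<epsilon> * (norm b + norm c) * norm c"
      if z: "norm z \<le> norm b + norm c" for z
    proof -
      have "norm ((D (a + z) - D a - H z) c) \<le> norm (D (a + z) - D a - H z) * norm c"
        by (rule norm_blinfun)
      also have "\<dots> \<le> \<epsilon> * norm z * norm c"
        using near[of "a + z"] z bc by (intro mult_right_mono) auto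
      also have "\<dots> \<le> \<epsilon> * (norm b + norm c) * norm c"
        using z \<epsilon> by (intro mult_right_mono mult_left_mono) auto
      finally show ?thesis by simp
    qed
    have "k' \<sigma> = (D (a + (b + \<sigma> *\<^sub>R c)) - D a - H (b + \<sigma> *\<^sub>R c)) c - (D (a + \<sigma> *\<^sub>R c) - D a - H (\<sigma> *\<^sub>R c)) c"
      by (simp add: k'_def blinfun.bilinear_simps linear_add[OF H] add.assoc)
    moreover have "norm (b + \<sigma> *\<^sub>R c) \<le> norm b + norm c"
      using norm_triangle_ineq[of b "\<sigma> *\<^sub>R c"] \<sigma>c by linarith
    moreover have "norm (\<sigma> *\<^sub>R c) \<le> norm b + norm c"
      using \<sigma>c norm_ge_zero[of b] by linarith
    ultimately show ?thesis
      using *[of "b + \<sigma> *\<^sub>R c"] *[of "\<sigma> *\<^sub>R c"] by linarith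
  qed
  have "norm (k 1 - k 0) \<le> 2 * \<epsilon> * (norm b + norm c) * norm c * norm (1 - 0 :: real)"
  proof (rule differentiable_bound[of "{0..1}", OF _ k])
    show "onorm (\<lambda>h. h *\<^sub>R k' \<sigma>) \<le> 2 * \<epsilon> * (norm b + norm c) * norm c" if "\<sigma> \<in> {0..1}" for \<sigma>
      using k'_bound[OF that] onorm_scaleR_left[of "\<lambda>h::real. h" "k' \<sigma>"] by (simp add: onorm_id)
  qed auto
  also have "\<dots> \<le> 2 * \<epsilon> * (norm b + norm c)\<^sup>2"
    unfolding power2_eq_square mult.assoc using \<epsilon>
    by (auto intro!: mult_left_mono)
  finally show ?thesis
    by (simp add: k_def algebra_simps)
qed

text \<open>The second difference is symmetric in its two increments and, by the estimate above, approximates both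
  \<open>H b c\<close> and \<open>H c b\<close>, with an error that is small compared to the squared size of the increments.\<close>

lemma second_derivative_symmetric:
  fixes \<psi> :: "'a::real_normed_vector \<Rightarrow> real" and D :: "'a \<Rightarrow> 'a \<Rightarrow>\<^sub>L real"
  assumes \<psi>: "\<And>x. (\<psi> has_derivative D x) (at x)"
    and D: "(D has_derivative H) (at a)"
  shows "H b c = H c b"
proof (rule ccontr)
  assume ne: "H b c \<noteq> H c b"
  have lin: "linear H"
    using D has_derivative_bounded_linear bounded_linear.linear by blast
  define n where "n = norm b + norm c"
  define \<epsilon> where "\<epsilon> = \<bar>H b c - H c b\<bar> / (4 * n\<^sup>2 + 1) / 2"
  have \<epsilon>: "0 < \<epsilon>" using ne unfolding \<epsilon>_def by (simp add: add_nonneg_pos)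
  from D \<epsilon> obtain d where d: "0 < d"
    and near: "\<And>x. norm (x - a) < d \<Longrightarrow> norm (D x - D a - H (x - a)) \<le> \<epsilon> * norm (x - a)"
    unfolding has_derivative_at_alt by blast
  define s where "s = d / (2 * (n + 1))"
  have n: "0 \<le> n" by (simp add: n_def)
  have s: "0 < s" using d n by (simp add: s_def)
  have sn: "s * n \<le> d / 2"
    using d n by (simp add: s_def divide_simps)
  have sbc: "norm (s *\<^sub>R b) + norm (s *\<^sub>R c) = s * n"
    using s by (simp add: n_def algebra_simps)
  have est: "\<bar>\<psi> (a + s *\<^sub>R p + s *\<^sub>R q) - \<psi> (a + s *\<^sub>R p) - \<psi> (a + s *\<^sub>R q) + \<psi> a - H (s *\<^sub>R p) (s *\<^sub>R q)\<bar>
      \<le> 2 * \<epsilon> * (s * n)\<^sup>2" if "norm (s *\<^sub>R p) + norm (s *\<^sub>R q) = s * n" for p q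
    using second_difference_estimate[OF \<psi> lin, of a "d / 2" \<epsilon> "s *\<^sub>R p" "s *\<^sub>R q"] near sn d \<epsilon> that
    by (simp add: less_imp_le)
  have "\<bar>H (s *\<^sub>R b) (s *\<^sub>R c) - H (s *\<^sub>R c) (s *\<^sub>R b)\<bar> \<le> 4 * \<epsilon> * (s * n)\<^sup>2"
    using est[of b c] est[of c b] sbc by (simp add: algebra_simps abs_le_iff)
  moreover have "H (s *\<^sub>R b) (s *\<^sub>R c) - H (s *\<^sub>R c) (s *\<^sub>R b) = s\<^sup>2 * (H b c - H c b)"
    by (simp add: linear_scale[OF lin] blinfun.bilinear_simps power2_eq_square algebra_simps)
  ultimately have "\<bar>s\<^sup>2 * (H b c - H c b)\<bar> \<le> 4 * \<epsilon> * (s * n)\<^sup>2"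
    by simp
  then have "s\<^sup>2 * \<bar>H b c - H c b\<bar> \<le> s\<^sup>2 * (4 * \<epsilon> * n\<^sup>2)"
    by (simp add: abs_mult power_mult_distrib mult_ac)
  then have "\<bar>H b c - H c b\<bar> \<le> \<epsilon> * (4 * n\<^sup>2)"
    using s by simp
  also have "\<dots> \<le> \<epsilon> * (4 * n\<^sup>2 + 1)"
    using \<epsilon> by simp
  also have "\<dots> = \<bar>H b c - H c b\<bar> / 2"
  proof -
    have "4 * n\<^sup>2 + 1 \<noteq> 0" by (metis add_nonneg_pos less_irrefl mult_nonneg_nonneg zero_le_numeral zero_le_power2 zero_less_one)
    then show ?thesis by (simp add: \<epsilon>_def field_simps)
  qed
  finally show False using ne by simp
qed

text \<open>A product is differentiable at a zero of one factor even if the other factor is merely continuous there.\<close>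

lemma has_derivative_vanishing_factor:
  fixes g :: "'a::real_normed_vector \<Rightarrow> 'b::real_normed_vector"
    and prod :: "'b \<Rightarrow> 'c::real_normed_vector \<Rightarrow> 'd::real_normed_vector"
  assumes "bounded_bilinear prod" and g: "(g has_derivative G) (at a)" and g0: "g a = 0"
    and F: "isCont F a"
  shows "((\<lambda>x. prod (g x) (F x)) has_derivative (\<lambda>h. prod (G h) (F a))) (at a)"
proof -
  interpret bounded_bilinear prod by fact
  obtain K where K: "0 \<le> K" "\<And>x y. norm (prod x y) \<le> norm x * norm y * K"
    using nonneg_bounded by blast
  interpret G: bounded_linear G using g by (rule has_derivative_bounded_linear)
  obtain C where C: "0 \<le> C" "\<And>h. norm (G h) \<le> norm h * C"
    using G.nonneg_bounded by blast
  have main: "((\<lambda>x. prod (g x) (F a)) has_derivative (\<lambda>h. prod (G h) (F a))) (at a)"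
    by (rule bounded_linear.has_derivative[OF bounded_linear_left g])
  have rest: "((\<lambda>x. prod (g x) (F x - F a)) has_derivative (\<lambda>h. 0)) (at a)"
    unfolding has_derivative_at_alt
  proof (intro conjI allI impI bounded_linear_zero)
    fix e :: real assume e: "0 < e"
    obtain d1 where d1: "0 < d1"
      "\<And>x. norm (x - a) < d1 \<Longrightarrow> norm (g x - g a - G (x - a)) \<le> 1 * norm (x - a)"
      using g unfolding has_derivative_at_alt by (metis zero_less_one)
    define \<eta> where "\<eta> = e / ((C + 1) * K + 1)"
    have \<eta>: "0 < \<eta>" using e C K by (simp add: \<eta>_def add_nonneg_pos)
    obtain d2 where d2: "0 < d2" "\<And>x. norm (x - a) < d2 \<Longrightarrow> norm (F x - F a) < \<eta>"
      using F \<eta> unfolding continuous_at_eps_delta dist_norm by blast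
    show "\<exists>d>0. \<forall>y. norm (y - a) < d \<longrightarrow>
        norm (prod (g y) (F y - F a) - prod (g a) (F a - F a) - 0) \<le> e * norm (y - a)"
    proof (intro exI[of _ "min d1 d2"] conjI allI impI)
      fix y assume y: "norm (y - a) < min d1 d2"
      have "norm (g y) \<le> norm (g y - G (y - a)) + norm (G (y - a))"
        using norm_triangle_sub[of "g y" "G (y - a)"] by simp
      also have "\<dots> \<le> (C + 1) * norm (y - a)"
        using d1(2)[of y] C(2)[of "y - a"] y g0 by (simp add: algebra_simps)
      finally have gy: "norm (g y) \<le> (C + 1) * norm (y - a)" .
      have "norm (prod (g y) (F y - F a)) \<le> norm (g y) * norm (F y - F a) * K"
        by (rule K)
      also have "\<dots> \<le> (C + 1) * norm (y - a) * \<eta> * K"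
        using gy d2(2)[of y] y \<eta> C K by (intro mult_right_mono mult_mono) auto
      also have "\<dots> = ((C + 1) * K) * \<eta> * norm (y - a)"
        by simp
      also have "\<dots> \<le> e * norm (y - a)"
      proof (rule mult_right_mono)
        have "(C + 1) * K * \<eta> \<le> ((C + 1) * K + 1) * \<eta>"
          using \<eta> by (simp add: algebra_simps)
        also have "\<dots> = e"
        proof -
          have "0 < (C + 1) * K + 1" using C K by (simp add: add_nonneg_pos)
          then show ?thesis by (simp add: \<eta>_def)
        qed
        finally show "(C + 1) * K * \<eta> \<le> e" .
      qed auto
      finally show "norm (prod (g y) (F y - F a) - prod (g a) (F a - F a) - 0) \<le> e * norm (y - a)"
        by (simp add: zero_right)
    qed (use d1 d2 in auto)
  qed
  have "((\<lambda>x. prod (g x) (F a) + prod (g x) (F x - F a)) has_derivative (\<lambda>h. prod (G h) (F a) + 0)) (at a)"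
    by (rule has_derivative_add[OF main rest])
  then show ?thesis
    by (simp add: add_right[symmetric])
qed

section \<open>Flows of velocity fields with small gradient\<close>

text \<open>The smallness of \<open>M * T\<close> is what makes \<open>growth_bound\<close> and \<open>linear_cocycle_exists\<close> applicable. The gradient \<open>J\<close> is
  a bounded linear map, since its operator norm enters all estimates.\<close>

locale smooth_flow =
  fixes T M :: real
    and v :: "real \<Rightarrow> 'a::euclidean_space \<Rightarrow> 'a"
    and J :: "real \<Rightarrow> 'a \<Rightarrow> 'a \<Rightarrow>\<^sub>L 'a"
    and X :: "real \<Rightarrow> 'a \<Rightarrow> 'a"
  assumes T_pos: "0 < T" and M_nonneg: "0 \<le> M" and MT: "M * T \<le> 1/4"
    and v_deriv: "\<And>t x. t \<in> {0..T} \<Longrightarrow> (v t has_derivative J t x) (at x)"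
    and J_bound: "\<And>t x. t \<in> {0..T} \<Longrightarrow> norm (J t x) \<le> M"
    and v_cont: "continuous_on ({0..T} \<times> UNIV) (\<lambda>(t, x). v t x)"
    and J_cont: "continuous_on ({0..T} \<times> UNIV) (\<lambda>(t, x). J t x)"
    and X_start: "\<And>a. X 0 a = a"
    and X_ode: "\<And>t a. t \<in> {0..T} \<Longrightarrow>
      ((\<lambda>\<tau>. X \<tau> a) has_vector_derivative v t (X t a)) (at t within {0..T})"
begin

lemma continuous_on_v [continuous_intros]:
  fixes h :: "'z::topological_space \<Rightarrow> real"
  assumes "continuous_on S h" "continuous_on S k" "\<And>z. z \<in> S \<Longrightarrow> h z \<in> {0..T}"
  shows "continuous_on S (\<lambda>z. v (h z) (k z))"
  using continuous_on_compose2[OF v_cont continuous_on_Pair[OF assms(1,2)]] assms(3)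
  by (auto simp: image_subset_iff)

lemma continuous_on_J [continuous_intros]:
  fixes h :: "'z::topological_space \<Rightarrow> real"
  assumes "continuous_on S h" "continuous_on S k" "\<And>z. z \<in> S \<Longrightarrow> h z \<in> {0..T}"
  shows "continuous_on S (\<lambda>z. J (h z) (k z))"
  using continuous_on_compose2[OF J_cont continuous_on_Pair[OF assms(1,2)]] assms(3)
  by (auto simp: image_subset_iff)

lemma v_lipschitz:
  assumes t: "t \<in> {0..T}"
  shows "norm (v t x - v t y) \<le> M * norm (x - y)"
  by (rule differentiable_bound[of UNIV "v t" "\<lambda>x. blinfun_apply (J t x)"])
    (use v_deriv[OF t] J_bound[OF t] in \<open>auto simp: norm_blinfun.rep_eq\<close>)

lemma solutions_stay_close:
  assumes y: "\<And>t. t \<in> {0..T} \<Longrightarrow> (y has_vector_derivative v t (y t)) (at t within {0..T})"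
    and z: "\<And>t. t \<in> {0..T} \<Longrightarrow> (z has_vector_derivative v t (z t)) (at t within {0..T})"
    and t: "t \<in> {0..T}"
  shows "norm (y t - z t) \<le> 4/3 * norm (y 0 - z 0)"
    and "norm (y t - z t - (y 0 - z 0)) \<le> 1/3 * norm (y 0 - z 0)"
proof -
  have d: "((\<lambda>\<tau>. y \<tau> - z \<tau>) has_vector_derivative v t (y t) - v t (z t)) (at t within {0..T})"
    if "t \<in> {0..T}" for t
    by (intro has_vector_derivative_diff y z that)
  show "norm (y t - z t) \<le> 4/3 * norm (y 0 - z 0)"
    and "norm (y t - z t - (y 0 - z 0)) \<le> 1/3 * norm (y 0 - z 0)"
    using growth_bound[OF less_imp_le[OF T_pos] MT M_nonneg order_refl d, of t] t v_lipschitz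
    by simp_all
qed

lemma flow_upper:
  assumes "t \<in> {0..T}"
  shows "norm (X t a - X t b) \<le> 4/3 * norm (a - b)"
  using solutions_stay_close(1)[of "\<lambda>t. X t a" "\<lambda>t. X t b", OF X_ode X_ode assms]
  by (simp add: X_start)

lemma flow_lower:
  assumes "t \<in> {0..T}"
  shows "2/3 * norm (a - b) \<le> norm (X t a - X t b)"
  using solutions_stay_close(2)[of "\<lambda>t. X t a" "\<lambda>t. X t b", OF X_ode X_ode assms]
    norm_triangle_ineq2[of "a - b" "X t a - X t b"]
  by (simp add: X_start norm_minus_commute)

lemma X_continuous_in_time: "continuous_on {0..T} (\<lambda>t. X t a)"
  using X_ode has_vector_derivative_continuous continuous_on_eq_continuous_within by blast

lemma X_continuous: "continuous_on ({0..T} \<times> UNIV) (\<lambda>(t, a). X t a)"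
proof -
  have "((\<lambda>(t, a). X t a) \<longlongrightarrow> X t0 a0) (at (t0, a0) within {0..T} \<times> UNIV)"
    if t0: "t0 \<in> {0..T}" for t0 a0
  proof -
  let ?F = "at (t0, a0) within {0..T} \<times> UNIV"
  have "continuous_on ({0..T} \<times> UNIV) (\<lambda>z. X (fst z) a0)"
    by (rule continuous_on_compose2[OF X_continuous_in_time]) (auto intro: continuous_intros)
  then have 1: "((\<lambda>z. X (fst z) a0) \<longlongrightarrow> X t0 a0) ?F"
    using t0 unfolding continuous_on_def by fastforce
  have "((\<lambda>z. 4/3 * norm (snd z - a0)) \<longlongrightarrow> 4/3 * norm (a0 - a0)) ?F"
    by (intro tendsto_intros) (auto intro!: tendsto_eq_intros)
  then have lim0: "((\<lambda>z. 4/3 * norm (snd z - a0)) \<longlongrightarrow> 0) ?F"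
    by simp
  have 2: "((\<lambda>z. X (fst z) (snd z) - X (fst z) a0) \<longlongrightarrow> 0) ?F"
  proof (rule Lim_null_comparison[OF _ lim0])
    show "\<forall>\<^sub>F z in ?F. norm (X (fst z) (snd z) - X (fst z) a0) \<le> 4/3 * norm (snd z - a0)"
      unfolding eventually_at_filter
      by (intro always_eventually allI impI flow_upper) auto
  qed
  show "((\<lambda>(t, a). X t a) \<longlongrightarrow> X t0 a0) ?F"
    using tendsto_add[OF 2 1] by (simp add: case_prod_beta')
  qed
  then show ?thesis by (auto simp: continuous_on_def)
qed

lemma continuous_on_X [continuous_intros]:
  fixes h :: "'z::topological_space \<Rightarrow> real"
  assumes "continuous_on S h" "continuous_on S k" "\<And>z. z \<in> S \<Longrightarrow> h z \<in> {0..T}"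
  shows "continuous_on S (\<lambda>z. X (h z) (k z))"
  using continuous_on_compose2[OF X_continuous continuous_on_Pair[OF assms(1,2)]] assms(3)
  by (auto simp: image_subset_iff)

lemma flow_bij:
  assumes t: "t \<in> {0..T}"
  shows "bij (X t)"
  by (rule bij_if_bilipschitz[OF _ _ flow_lower[OF t]]) (auto intro!: continuous_intros t)

text \<open>The candidate for the derivative is the solution \<open>F\<close> of the linearised equation along a path. The remainder
  \<open>X(y) - X(a) - F (y - a)\<close> solves this equation with a forcing that is small compared to \<open>norm (y - a)\<close>,
  because \<open>J\<close> is continuous, uniformly along the path.\<close>

lemma flow_derivative_exists:
  "\<exists>F. continuous_on ({0..T} \<times> UNIV) (\<lambda>(t, a). F t a) \<and> (\<forall>a. F 0 a = id_blinfun) \<and>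
    (\<forall>t\<in>{0..T}. \<forall>a. ((\<lambda>\<tau>. F \<tau> a) has_vector_derivative J t (X t a) o\<^sub>L F t a) (at t within {0..T}) \<and>
      (X t has_derivative blinfun_apply (F t a)) (at a))"
proof -
  have cont: "continuous_on ({0..T} \<times> UNIV) (\<lambda>(t, a). J t (X t a))"
    unfolding split_beta by (intro continuous_intros) auto
  obtain F :: "real \<Rightarrow> 'a \<Rightarrow> 'a \<Rightarrow>\<^sub>L 'a" where F_cont: "continuous_on ({0..T} \<times> UNIV) (\<lambda>(t, a). F t a)"
    and F_start: "\<And>a. F 0 a = id_blinfun"
    and F_ode: "\<And>t a. t \<in> {0..T} \<Longrightarrow>
      ((\<lambda>\<tau>. F \<tau> a) has_vector_derivative J t (X t a) o\<^sub>L F t a) (at t within {0..T})"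
    using linear_cocycle_exists[OF less_imp_le[OF T_pos] MT M_nonneg cont J_bound] by blast
  have "(X t has_derivative blinfun_apply (F t a)) (at a)" if t: "t \<in> {0..T}" for t a
    unfolding has_derivative_at_alt
  proof (intro conjI allI impI blinfun.bounded_linear_right)
    fix e :: real assume e: "0 < e"
    \<comment> \<open>The final estimate is \<open>4/3 \<sqdot> T \<sqdot> (4/3 \<sqdot> \<epsilon>) = 8/9 \<sqdot> e\<close>.\<close>
    define \<epsilon> where "\<epsilon> = e / (2 * T)"
    have \<epsilon>: "0 < \<epsilon>" using e T_pos by (simp add: \<epsilon>_def)
    have "continuous_on (UNIV \<times> {0..T}) (\<lambda>(z, \<tau>). J \<tau> (X \<tau> a + z))"
      unfolding split_beta by (intro continuous_intros) auto
    then obtain U where U: "0 \<in> U" "open U"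
      and JU: "\<forall>z\<in>U \<inter> UNIV. \<forall>\<tau>\<in>{0..T}.
        dist (case (z, \<tau>) of (z, \<tau>) \<Rightarrow> J \<tau> (X \<tau> a + z)) (case (0, \<tau>) of (z, \<tau>) \<Rightarrow> J \<tau> (X \<tau> a + z)) \<le> \<epsilon>"
      by (rule continuous_on_prod_compactE[OF _ compact_Icc UNIV_I \<epsilon>])
    obtain \<delta> where \<delta>: "0 < \<delta>" "ball 0 \<delta> \<subseteq> U"
      using U open_contains_ball by blast
    have lin: "norm (v \<tau> y - v \<tau> (X \<tau> a) - J \<tau> (X \<tau> a) (y - X \<tau> a)) \<le> norm (y - X \<tau> a) * \<epsilon>"
      if \<tau>: "\<tau> \<in> {0..T}" and y: "norm (y - X \<tau> a) < \<delta>" for \<tau> y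
    proof (rule differentiable_bound_linearization[where S = "ball (X \<tau> a) \<delta>" and
          f' = "\<lambda>x. blinfun_apply (J \<tau> x)"])
      show "X \<tau> a + s *\<^sub>R (y - X \<tau> a) \<in> ball (X \<tau> a) \<delta>" if "s \<in> {0..1}" for s
      proof -
        have "norm (s *\<^sub>R (y - X \<tau> a)) \<le> norm (y - X \<tau> a)"
          using that mult_right_mono[of s 1 "norm (y - X \<tau> a)"] by simp
        then show ?thesis using y by (simp add: dist_norm)
      qed
      show "(v \<tau> has_derivative blinfun_apply (J \<tau> x)) (at x within ball (X \<tau> a) \<delta>)" for x
        using v_deriv[OF \<tau>] has_derivative_at_withinI by blast
      show "onorm (blinfun_apply (J \<tau> x) - blinfun_apply (J \<tau> (X \<tau> a))) \<le> \<epsilon>"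
        if "x \<in> ball (X \<tau> a) \<delta>" for x
      proof -
        have "x - X \<tau> a \<in> U"
          using that \<delta> by (auto simp: dist_norm norm_minus_commute)
        then have "norm (J \<tau> x - J \<tau> (X \<tau> a)) \<le> \<epsilon>"
          using JU[rule_format, of "x - X \<tau> a" \<tau>] \<tau> by (simp add: dist_norm)
        then show ?thesis
          by (simp add: norm_blinfun.rep_eq fun_diff_def blinfun.bilinear_simps[symmetric])
      qed
    qed (use \<delta> in auto)
    show "\<exists>d>0. \<forall>y. norm (y - a) < d \<longrightarrow> norm (X t y - X t a - F t a (y - a)) \<le> e * norm (y - a)"
    proof (intro exI[of _ "3/4 * \<delta>"] conjI allI impI)
      fix y assume y: "norm (y - a) < 3/4 * \<delta>"
      define R where "R \<tau> = X \<tau> y - X \<tau> a - F \<tau> a (y - a)" for \<tau>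
      have R0: "R 0 = 0" by (simp add: R_def X_start F_start)
      have R_ode: "(R has_vector_derivative v \<tau> (X \<tau> y) - v \<tau> (X \<tau> a) - J \<tau> (X \<tau> a) (F \<tau> a (y - a)))
          (at \<tau> within {0..T})" if \<tau>: "\<tau> \<in> {0..T}" for \<tau>
        unfolding R_def
        using bounded_linear.has_vector_derivative[OF blinfun.bounded_linear_left F_ode[OF \<tau>]]
        by (auto intro!: has_vector_derivative_diff X_ode \<tau>)
      have R_growth: "norm (v \<tau> (X \<tau> y) - v \<tau> (X \<tau> a) - J \<tau> (X \<tau> a) (F \<tau> a (y - a)))
          \<le> M * norm (R \<tau>) + 4/3 * norm (y - a) * \<epsilon>" if \<tau>: "\<tau> \<in> {0..T}" for \<tau>
      proof -
        have close: "norm (X \<tau> y - X \<tau> a) \<le> 4/3 * norm (y - a)"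
          by (rule flow_upper[OF \<tau>])
        have "v \<tau> (X \<tau> y) - v \<tau> (X \<tau> a) - J \<tau> (X \<tau> a) (F \<tau> a (y - a))
            = J \<tau> (X \<tau> a) (R \<tau>) + (v \<tau> (X \<tau> y) - v \<tau> (X \<tau> a) - J \<tau> (X \<tau> a) (X \<tau> y - X \<tau> a))"
          by (simp add: R_def blinfun.bilinear_simps)
        also have "norm \<dots> \<le> norm (J \<tau> (X \<tau> a)) * norm (R \<tau>) + norm (X \<tau> y - X \<tau> a) * \<epsilon>"
        proof (intro norm_triangle_mono norm_blinfun lin \<tau>)
          show "norm (X \<tau> y - X \<tau> a) < \<delta>"
            using close y by linarith
        qed
        also have "\<dots> \<le> M * norm (R \<tau>) + 4/3 * norm (y - a) * \<epsilon>"
          using close \<epsilon> J_bound[OF \<tau>] by (intro add_mono mult_right_mono) auto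
        finally show ?thesis .
      qed
      have "norm (R t) \<le> 4/3 * (norm (R 0) + T * (4/3 * norm (y - a) * \<epsilon>))"
        by (rule growth_bound(1)[OF less_imp_le[OF T_pos] MT M_nonneg _ R_ode R_growth t])
          (use \<epsilon> in auto)
      also have "\<dots> = 8/9 * (e * norm (y - a))"
        using T_pos by (simp add: R0 \<epsilon>_def)
      also have "\<dots> \<le> e * norm (y - a)"
        using e by simp
      finally show "norm (X t y - X t a - F t a (y - a)) \<le> e * norm (y - a)"
        by (simp add: R_def)
    qed (use \<delta> in auto)
  qed
  with F_cont F_start F_ode show ?thesis by blast
qed

definition deformation :: "real \<Rightarrow> 'a \<Rightarrow> 'a \<Rightarrow>\<^sub>L 'a"
  where "deformation = (SOME F. continuous_on ({0..T} \<times> UNIV) (\<lambda>(t, a). F t a) \<and>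
    (\<forall>a. F 0 a = id_blinfun) \<and>
    (\<forall>t\<in>{0..T}. \<forall>a. ((\<lambda>\<tau>. F \<tau> a) has_vector_derivative J t (X t a) o\<^sub>L F t a) (at t within {0..T}) \<and>
      (X t has_derivative blinfun_apply (F t a)) (at a)))"

lemma deformation_cont: "continuous_on ({0..T} \<times> UNIV) (\<lambda>(t, a). deformation t a)"
  and deformation_start: "deformation 0 a = id_blinfun"
  and deformation_ode: "t \<in> {0..T} \<Longrightarrow>
    ((\<lambda>\<tau>. deformation \<tau> a) has_vector_derivative J t (X t a) o\<^sub>L deformation t a) (at t within {0..T})"
  and X_deriv: "t \<in> {0..T} \<Longrightarrow> (X t has_derivative deformation t a) (at a)"
  using someI_ex[OF flow_derivative_exists] unfolding deformation_def[symmetric] by blast+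

lemma continuous_on_deformation [continuous_intros]:
  fixes h :: "'z::topological_space \<Rightarrow> real"
  assumes "continuous_on S h" "continuous_on S k" "\<And>z. z \<in> S \<Longrightarrow> h z \<in> {0..T}"
  shows "continuous_on S (\<lambda>z. deformation (h z) (k z))"
  using continuous_on_compose2[OF deformation_cont continuous_on_Pair[OF assms(1,2)]] assms(3)
  by (auto simp: image_subset_iff)

lemma deformation_apply_ode:
  assumes t: "t \<in> {0..T}"
  shows "((\<lambda>\<tau>. deformation \<tau> a b) has_vector_derivative J t (X t a) (deformation t a b)) (at t within {0..T})"
  using bounded_linear.has_vector_derivative[OF blinfun.bounded_linear_left deformation_ode[OF t]]
  by simp

lemma deformation_bounds:
  assumes t: "t \<in> {0..T}"
  shows "norm (deformation t a b) \<le> 4/3 * norm b"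
    and "2/3 * norm b \<le> norm (deformation t a b)"
proof -
  have g: "norm (J t (X t a) (deformation t a b)) \<le> M * norm (deformation t a b) + 0" if "t \<in> {0..T}" for t
    using norm_blinfun[of "J t (X t a)" "deformation t a b"]
      mult_right_mono[OF J_bound[OF that, of "X t a"], of "norm (deformation t a b)"] by simp
  note gb = growth_bound[OF less_imp_le[OF T_pos] MT M_nonneg order_refl deformation_apply_ode g t]
  show "norm (deformation t a b) \<le> 4/3 * norm b"
    using gb(1) by (simp add: deformation_start)
  show "2/3 * norm b \<le> norm (deformation t a b)"
    using gb(2) norm_triangle_ineq2[of b "deformation t a b"]
    by (simp add: deformation_start norm_minus_commute)
qed

end

section \<open>Vorticity transport in a rotating frame\<close>

lemma bounded_bilinear_cross3: "bounded_bilinear cross3"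
  using bilinear_cross bilinear_conv_bounded_bilinear by blast

lemma bounded_linear_cross3: "bounded_linear (cross3 a)"
  by (rule bounded_bilinear.bounded_linear_right[OF bounded_bilinear_cross3])

text \<open>The curl is the dual vector of the antisymmetric part of the derivative.\<close>

lemma curl_dot_cross:
  assumes "(f has_derivative f') (at x)"
  shows "curl f x \<bullet> cross3 b c = f' b \<bullet> c - f' c \<bullet> b"
proof -
  define A where "A = jacobian f (at x)"
  have "f differentiable (at x)"
    using assms by (auto simp: differentiable_def)
  then have "(f has_derivative (\<lambda>h. A *v h)) (at x)"
    unfolding A_def jacobian_works .
  then have f': "f' = (\<lambda>h. A *v h)"
    using assms has_derivative_unique by blast
  show ?thesis
    unfolding f' curl_def A_def[symmetric] Let_def
    by (simp add: cross3_simps matrix_vector_mult_def)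
qed

lemma vector_eq_if_dot_cross_eq:
  assumes "\<And>b c. x \<bullet> cross3 b c = y \<bullet> cross3 b c"
  shows "x = y"
proof -
  have "x \<bullet> axis i 1 = y \<bullet> axis i 1" for i
    using assms[of "axis 1 1" "axis 2 1"] assms[of "axis 2 1" "axis 3 1"] assms[of "axis 3 1" "axis 1 1"]
      exhaust_3[of i]
    by (auto simp: cross_basis)
  then show ?thesis
    by (simp add: vec_eq_iff inner_axis)
qed

text \<open>Both sides are the derivative at \<open>s = 0\<close> of the volume spanned by \<open>exp (s A)\<close> times the vectors
  \<open>x\<close>, \<open>y\<close>, \<open>z\<close>.\<close>

lemma triple_product_rate:
  fixes A :: "real^3^3"
  shows "(A *v x) \<bullet> cross3 y z + x \<bullet> cross3 (A *v y) z + x \<bullet> cross3 y (A *v z)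
    = trace A * (x \<bullet> cross3 y z)"
  by (simp add: cross3_simps matrix_vector_mult_def trace_def)

text \<open>Here \<open>W\<close> is the rotation rate, \<open>p\<close> the pressure and \<open>P\<close> its gradient, whose continuity follows from that of the
  other terms in the momentum equation.\<close>

locale rotating_flow = smooth_flow T M v J X
  for T M :: real
    and v :: "real \<Rightarrow> real^3 \<Rightarrow> real^3"
    and J :: "real \<Rightarrow> real^3 \<Rightarrow> (real^3) \<Rightarrow>\<^sub>L (real^3)"
    and X :: "real \<Rightarrow> real^3 \<Rightarrow> real^3" +
  fixes W :: real
    and v\<^sub>t :: "real \<Rightarrow> real^3 \<Rightarrow> real^3"
    and p :: "real \<Rightarrow> real^3 \<Rightarrow> real"
    and P :: "real \<Rightarrow> real^3 \<Rightarrow> real^3"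
  assumes W_pos: "0 < W"
    and v_time: "\<And>t x. t \<in> {0..T} \<Longrightarrow>
      ((\<lambda>\<tau>. v \<tau> x) has_vector_derivative v\<^sub>t t x) (at t within {0..T})"
    and v\<^sub>t_cont: "continuous_on ({0..T} \<times> UNIV) (\<lambda>(t, x). v\<^sub>t t x)"
    and p_deriv: "\<And>t x. t \<in> {0..T} \<Longrightarrow> (p t has_derivative (\<lambda>h. P t x \<bullet> h)) (at x)"
    and momentum: "\<And>t x. t \<in> {0..T} \<Longrightarrow>
      v\<^sub>t t x + J t x (v t x) + P t x + (2 * W) *\<^sub>R cross3 e3 (v t x) = 0"
    and incompressible: "\<And>t x. t \<in> {0..T} \<Longrightarrow> (\<Sum>i\<in>UNIV. J t x (axis i 1) $ i) = 0"
begin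

lemma P_eq: "t \<in> {0..T} \<Longrightarrow> P t x = - v\<^sub>t t x - J t x (v t x) - (2 * W) *\<^sub>R cross3 e3 (v t x)"
  using momentum[of t x] by (simp add: algebra_simps eq_neg_iff_add_eq_0)

lemma continuous_on_v\<^sub>t [continuous_intros]:
  fixes h :: "'z::topological_space \<Rightarrow> real"
  assumes "continuous_on S h" "continuous_on S k" "\<And>z. z \<in> S \<Longrightarrow> h z \<in> {0..T}"
  shows "continuous_on S (\<lambda>z. v\<^sub>t (h z) (k z))"
  using continuous_on_compose2[OF v\<^sub>t_cont continuous_on_Pair[OF assms(1,2)]] assms(3)
  by (auto simp: image_subset_iff)

lemma continuous_on_cross3 [continuous_intros]:
  fixes f g :: "'z::topological_space \<Rightarrow> real^3"
  assumes "continuous_on S f" "continuous_on S g"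
  shows "continuous_on S (\<lambda>z. cross3 (f z) (g z))"
  by (rule bounded_bilinear.continuous_on[OF bounded_bilinear_cross3 assms])

lemma continuous_on_P [continuous_intros]:
  fixes h :: "'z::topological_space \<Rightarrow> real"
  assumes "continuous_on S h" "continuous_on S k" "\<And>z. z \<in> S \<Longrightarrow> h z \<in> {0..T}"
  shows "continuous_on S (\<lambda>z. P (h z) (k z))"
proof -
  have "continuous_on S (\<lambda>z. - v\<^sub>t (h z) (k z) - J (h z) (k z) (v (h z) (k z))
      - (2 * W) *\<^sub>R cross3 e3 (v (h z) (k z)))"
    by (intro continuous_intros assms)
  then show ?thesis
    using P_eq assms(3) by (simp cong: continuous_on_cong)
qed

text \<open>The pressure is determined only up to a function of time, which may be irregular. Subtracting the value at
  the origin leaves a line integral of the pressure gradient, and this is continuous.\<close>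

lemma normalised_pressure_cont:
  "continuous_on ({0..T} \<times> UNIV) (\<lambda>z. p (fst z) (snd z) - p (fst z) 0)"
proof -
  have eq: "p t x - p t 0 = integral (cbox 0 1) (\<lambda>s. P t (s *\<^sub>R x) \<bullet> x)" if t: "t \<in> {0..T}" for t x
  proof -
    have "((\<lambda>s. P t (s *\<^sub>R x) \<bullet> x) has_integral p t (1 *\<^sub>R x) - p t (0 *\<^sub>R x)) {0..1::real}"
    proof (rule fundamental_theorem_of_calculus)
      fix s :: real
      have "((\<lambda>s. p t (s *\<^sub>R x)) has_derivative (\<lambda>h. P t (s *\<^sub>R x) \<bullet> (h *\<^sub>R x))) (at s within {0..1})"
        by (rule has_derivative_compose[OF _ p_deriv[OF t]]) (auto intro!: derivative_eq_intros)
      then show "((\<lambda>s. p t (s *\<^sub>R x)) has_vector_derivative P t (s *\<^sub>R x) \<bullet> x) (at s within {0..1})"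
        by (simp add: has_vector_derivative_def)
    qed simp
    then show ?thesis by (simp add: integral_unique)
  qed
  have "continuous_on ({0..T} \<times> UNIV) (\<lambda>z. integral (cbox 0 1) (\<lambda>s. P (fst z) (s *\<^sub>R snd z) \<bullet> snd z))"
    by (intro integral_continuous_on_param) (auto simp: split_beta intro!: continuous_intros)
  then show ?thesis
    by (rule continuous_on_eq) (auto simp: eq)
qed

lemma velocity_along_path:
  assumes t: "t \<in> {0..T}"
  shows "((\<lambda>\<tau>. v \<tau> (X \<tau> a)) has_vector_derivative
      - P t (X t a) - (2 * W) *\<^sub>R cross3 e3 (v t (X t a))) (at t within {0..T})"
proof -
  have total: "((\<lambda>(\<tau>, x). v \<tau> x) has_derivative (\<lambda>(h, k). h *\<^sub>R v\<^sub>t t (X t a) + J t (X t a) k))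
      (at (t, X t a) within {0..T} \<times> UNIV)"
  proof (rule has_derivative_partialsI)
    show "((\<lambda>\<tau>. v \<tau> (X t a)) has_derivative (\<lambda>h. h *\<^sub>R v\<^sub>t t (X t a))) (at t within {0..T})"
      using v_time[OF t] by (simp add: has_vector_derivative_def)
    show "continuous (at (t, X t a) within {0..T} \<times> UNIV) (\<lambda>(t, x). J t x)"
      using J_cont t continuous_on_eq_continuous_within by blast
  qed (use v_deriv in auto)
  have path: "((\<lambda>\<tau>. (\<tau>, X \<tau> a)) has_derivative (\<lambda>h. (h, h *\<^sub>R v t (X t a)))) (at t within {0..T})"
    using X_ode[OF t] by (auto intro!: derivative_eq_intros simp: has_vector_derivative_def)
  have "((\<lambda>\<tau>. (\<lambda>(\<tau>, x). v \<tau> x) (\<tau>, X \<tau> a)) has_derivative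
      (\<lambda>h. (\<lambda>(h, k). h *\<^sub>R v\<^sub>t t (X t a) + J t (X t a) k) (h, h *\<^sub>R v t (X t a)))) (at t within {0..T})"
    by (rule has_derivative_in_compose[OF path has_derivative_subset[OF total]]) auto
  then show ?thesis
    using momentum[OF t, of "X t a"]
    by (simp add: has_vector_derivative_def blinfun.bilinear_simps P_eq[OF t] algebra_simps)
qed

text \<open>The velocity, seen from the inertial frame, of the particle with label \<open>a\<close>.\<close>

definition absolute_velocity :: "real \<Rightarrow> real^3 \<Rightarrow> real^3"
  where "absolute_velocity t a = v t (X t a) + W *\<^sub>R cross3 e3 (X t a)"

text \<open>The Lagrangian density of a particle in the rotating frame, with the centrifugal potential counted as part of the
  pressure; its time integral is the potential in the Weber formula.\<close>

definition action_density :: "real \<Rightarrow> real^3 \<Rightarrow> real"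
  where "action_density t a = - (p t (X t a) - p t 0)
    + 1/2 * (v t (X t a) \<bullet> v t (X t a)) + W * (cross3 e3 (X t a) \<bullet> v t (X t a))"

definition action_gradient :: "real \<Rightarrow> real^3 \<Rightarrow> (real^3) \<Rightarrow>\<^sub>L real"
  where "action_gradient t a =
    (blinfun_inner_right (- P t (X t a) - W *\<^sub>R cross3 e3 (v t (X t a))) o\<^sub>L deformation t a)
    + (blinfun_inner_right (absolute_velocity t a) o\<^sub>L (J t (X t a) o\<^sub>L deformation t a))"

lemma action_density_deriv:
  assumes t: "t \<in> {0..T}"
  shows "(action_density t has_derivative action_gradient t a) (at a)"
proof -
  have dv: "((\<lambda>a. v t (X t a)) has_derivative (\<lambda>h. J t (X t a) (deformation t a h))) (at a)"
    by (rule has_derivative_compose[OF X_deriv[OF t] v_deriv[OF t]])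
  have dp: "((\<lambda>a. p t (X t a)) has_derivative (\<lambda>h. P t (X t a) \<bullet> deformation t a h)) (at a)"
    by (rule has_derivative_compose[OF X_deriv[OF t] p_deriv[OF t]])
  have dc: "((\<lambda>a. cross3 e3 (X t a)) has_derivative (\<lambda>h. cross3 e3 (deformation t a h))) (at a)"
    by (rule bounded_linear.has_derivative[OF bounded_linear_cross3 X_deriv[OF t]])
  have swap: "W * (v t (X t a) \<bullet> cross3 e3 k) = - (W * (k \<bullet> cross3 e3 (v t (X t a))))" for k
    by (simp add: cross3_simps)
  show ?thesis
    unfolding action_density_def[abs_def]
    by (rule has_derivative_eq_rhs[OF has_derivative_add[OF has_derivative_add[OF
          has_derivative_minus[OF has_derivative_diff[OF dp has_derivative_const]]
          has_derivative_mult_right[OF has_derivative_inner[OF dv dv]]]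
          has_derivative_mult_right[OF has_derivative_inner[OF dc dv]]]])
       (use swap in \<open>auto simp: fun_eq_iff action_gradient_def absolute_velocity_def blinfun.bilinear_simps
          inner_commute algebra_simps inner_diff_left inner_add_left inner_minus_left\<close>)
qed

text \<open>Along a particle path the rate of change of \<open>g \<bullet> F b\<close>, with \<open>g\<close> the absolute velocity, is the derivative
  in direction \<open>b\<close> of the action density; the Coriolis term is absorbed by the antisymmetry of
  \<open>x, y \<mapsto> (e\<^sub>3 \<times> x) \<bullet> y\<close>.\<close>

lemma circulation_density_rate:
  assumes t: "t \<in> {0..T}"
  shows "((\<lambda>\<tau>. absolute_velocity \<tau> a \<bullet> deformation \<tau> a b) has_vector_derivative
    action_gradient t a b) (at t within {0..T})"
proof -
  have dg: "((\<lambda>\<tau>. absolute_velocity \<tau> a) has_vector_derivative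
      - P t (X t a) - W *\<^sub>R cross3 e3 (v t (X t a))) (at t within {0..T})"
    unfolding absolute_velocity_def
    by (rule has_vector_derivative_eq_rhs[OF has_vector_derivative_add[OF velocity_along_path[OF t]
        has_vector_derivative_scaleR[OF DERIV_const bounded_linear.has_vector_derivative[OF bounded_linear_cross3 X_ode[OF t]]]]])
      (simp add: algebra_simps flip: scaleR_add_left)
  show ?thesis
    using bounded_bilinear.has_vector_derivative[OF bounded_bilinear_inner dg deformation_apply_ode[OF t]]
    by (simp add: action_gradient_def blinfun.bilinear_simps add.commute)
qed

lemma action_gradient_cont: "continuous_on ({0..T} \<times> UNIV) (\<lambda>z. action_gradient (fst z) (snd z))"
  unfolding action_gradient_def absolute_velocity_def
  by (intro continuous_intros bounded_linear.continuous_on[OF bounded_linear_blinfun_inner_right]) auto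

text \<open>The action density is integrated in time. Its gradient is found by differentiation under the integral sign, and
  the fundamental theorem of calculus applies to this gradient by \<open>circulation_density_rate\<close>.\<close>

lemma weber_formula:
  assumes t: "t \<in> {0..T}"
  obtains \<phi> where "\<And>a. (\<phi> has_derivative
    (blinfun_inner_right (absolute_velocity t a) o\<^sub>L deformation t a)
    - blinfun_inner_right (absolute_velocity 0 a)) (at a)"
proof
  fix a
  have sub: "{0..t} \<subseteq> {0..T}" using t by auto
  have cont_in_a: "continuous_on {0..t} (\<lambda>\<tau>. action_density \<tau> a)" for a
  proof -
    have "continuous_on {0..t} (\<lambda>\<tau>. (\<lambda>z. p (fst z) (snd z) - p (fst z) 0) (\<tau>, X \<tau> a))"
      by (rule continuous_on_compose2[OF normalised_pressure_cont])
        (use sub in \<open>auto intro!: continuous_intros\<close>)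
    then have p: "continuous_on {0..t} (\<lambda>\<tau>. p \<tau> (X \<tau> a) - p \<tau> 0)"
      by simp
    show ?thesis
      unfolding action_density_def
      by (intro continuous_on_add continuous_on_minus p continuous_intros) (use sub in auto)
  qed
  have cont_grad: "continuous_on (UNIV \<times> cbox 0 t) (\<lambda>(a, \<tau>). action_gradient \<tau> a)"
    unfolding case_prod_beta'
    by (rule continuous_on_compose2[OF action_gradient_cont, of _ "\<lambda>z. (snd z, fst z)", simplified])
      (use sub in \<open>auto intro!: continuous_intros\<close>)
  have D: "((\<lambda>a. integral (cbox 0 t) (\<lambda>\<tau>. action_density \<tau> a)) has_derivative
      integral (cbox 0 t) (\<lambda>\<tau>. action_gradient \<tau> a)) (at a within UNIV)"
    by (rule leibniz_rule[OF _ _ cont_grad])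
      (use sub in \<open>auto intro!: action_density_deriv integrable_continuous_real cont_in_a\<close>)
  have cont_grad_a: "continuous_on {0..t} (\<lambda>\<tau>. action_gradient \<tau> a)"
    by (rule continuous_on_compose2[OF action_gradient_cont, of _ "\<lambda>\<tau>. (\<tau>, a)", simplified])
      (use sub in \<open>auto intro!: continuous_intros\<close>)
  have "integral (cbox 0 t) (\<lambda>\<tau>. action_gradient \<tau> a)
    = (blinfun_inner_right (absolute_velocity t a) o\<^sub>L deformation t a)
      - blinfun_inner_right (absolute_velocity 0 a)"
  proof (rule blinfun_eqI)
    fix b
    have "((\<lambda>\<tau>. action_gradient \<tau> a b) has_integral
        absolute_velocity t a \<bullet> deformation t a b - absolute_velocity 0 a \<bullet> deformation 0 a b) {0..t}"
      by (rule fundamental_theorem_of_calculus)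
        (use sub t in \<open>auto intro!: has_vector_derivative_within_subset[OF circulation_density_rate sub]\<close>)
    then show "integral (cbox 0 t) (\<lambda>\<tau>. action_gradient \<tau> a) b
      = ((blinfun_inner_right (absolute_velocity t a) o\<^sub>L deformation t a)
        - blinfun_inner_right (absolute_velocity 0 a)) b"
      by (simp add: blinfun_apply_integral[OF integrable_continuous_real[OF cont_grad_a]]
          integral_unique blinfun.bilinear_simps deformation_start)
  qed
  with D show "((\<lambda>a. integral (cbox 0 t) (\<lambda>\<tau>. action_density \<tau> a)) has_derivative
    (blinfun_inner_right (absolute_velocity t a) o\<^sub>L deformation t a)
    - blinfun_inner_right (absolute_velocity 0 a)) (at a)"
    by simp
qed

lemma absolute_velocity_deriv:
  assumes t: "t \<in> {0..T}"
  shows "(absolute_velocity t has_derivative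
    (\<lambda>h. J t (X t a) (deformation t a h) + W *\<^sub>R cross3 e3 (deformation t a h))) (at a)"
  unfolding absolute_velocity_def[abs_def]
  by (intro has_derivative_add has_derivative_scaleR_right
      has_derivative_compose[OF X_deriv[OF t] v_deriv[OF t]]
      bounded_linear.has_derivative[OF bounded_linear_cross3 X_deriv[OF t]])

text \<open>Kelvin's theorem in infinitesimal form. The flux of the absolute vorticity through the parallelogram
  spanned by \<open>F b\<close> and \<open>F c\<close> is \<open>G b \<bullet> F c - G c \<bullet> F b\<close>, where \<open>G\<close> is the derivative of the absolute
  velocity. The Weber formula turns the difference of this expression at times \<open>t\<close> and \<open>0\<close> into the
  antisymmetric part of a second derivative.\<close>

lemma vorticity_flux_conserved:
  assumes t: "t \<in> {0..T}"
  shows "(curl (v t) (X t a) + (2 * W) *\<^sub>R e3) \<bullet> cross3 (deformation t a b) (deformation t a c)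
    = (curl (v 0) a + (2 * W) *\<^sub>R e3) \<bullet> cross3 b c"
proof -
  have 0: "0 \<in> {0..T}" using T_pos by simp
  obtain \<phi> where \<phi>: "\<And>a. (\<phi> has_derivative
      (blinfun_inner_right (absolute_velocity t a) o\<^sub>L deformation t a)
      - blinfun_inner_right (absolute_velocity 0 a)) (at a)"
    using weber_formula[OF t] by blast
  define G where "G h = J t (X t a) (deformation t a h) + W *\<^sub>R cross3 e3 (deformation t a h)" for h
  define G0 where "G0 h = J 0 a h + W *\<^sub>R cross3 e3 h" for h
  \<comment> \<open>Subtracting this term replaces the factor \<open>g(x)\<close> in front of the merely continuous \<open>F(x)\<close> by \<open>g(x) - g(a)\<close>,
    which vanishes at \<open>a\<close>.\<close>
  define \<psi> where "\<psi> x = \<phi> x - absolute_velocity t a \<bullet> X t x" for x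
  define D where "D x = (blinfun_inner_right (absolute_velocity t x - absolute_velocity t a) o\<^sub>L deformation t x)
      - blinfun_inner_right (absolute_velocity 0 x)" for x
  have \<psi>: "(\<psi> has_derivative D x) (at x)" for x
    unfolding \<psi>_def D_def
    by (rule has_derivative_eq_rhs[OF has_derivative_diff[OF \<phi> has_derivative_inner_right[OF X_deriv[OF t]]]])
       (simp add: fun_eq_iff blinfun.bilinear_simps inner_diff_left)
  have bil: "bounded_bilinear (\<lambda>y A. blinfun_inner_right y o\<^sub>L (A :: (real^3) \<Rightarrow>\<^sub>L (real^3)))"
    by (rule bounded_bilinear.comp1[OF bounded_bilinear_blinfun_compose bounded_linear_blinfun_inner_right])
  have contF: "isCont (deformation t) a"
    using continuous_on_deformation[of UNIV "\<lambda>_. t" "\<lambda>x. x"] t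
    by (simp add: continuous_on_eq_continuous_at)
  have dg: "((\<lambda>x. absolute_velocity t x - absolute_velocity t a) has_derivative G) (at a)"
    unfolding G_def
    by (rule has_derivative_eq_rhs[OF has_derivative_diff[OF absolute_velocity_deriv[OF t] has_derivative_const]]) simp
  have dg0: "(absolute_velocity 0 has_derivative G0) (at a)"
    using absolute_velocity_deriv[OF 0, of a] unfolding G0_def by (simp add: deformation_start X_start)
  have "(D has_derivative (\<lambda>h. (blinfun_inner_right (G h) o\<^sub>L deformation t a) - blinfun_inner_right (G0 h))) (at a)"
    unfolding D_def
    by (intro has_derivative_diff has_derivative_vanishing_factor[OF bil dg _ contF]
        bounded_linear.has_derivative[OF bounded_linear_blinfun_inner_right dg0]) simp
  from second_derivative_symmetric[OF \<psi> this, of b c]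
  have sym: "G b \<bullet> deformation t a c - G c \<bullet> deformation t a b = G0 b \<bullet> c - G0 c \<bullet> b"
    by (simp add: blinfun.bilinear_simps)
  have rot: "2 * W * (e3 \<bullet> cross3 x y) = W * (cross3 e3 x \<bullet> y) - W * (cross3 e3 y \<bullet> x)" for x y
    by (simp add: cross3_simps)
  show ?thesis
    using sym rot[of b c] rot[of "deformation t a b" "deformation t a c"]
    by (simp add: inner_add_left curl_dot_cross[OF v_deriv[OF t]] curl_dot_cross[OF v_deriv[OF 0]]
        G_def G0_def algebra_simps)
qed

text \<open>Liouville's formula: the logarithmic derivative of the determinant is the divergence of the velocity.\<close>

lemma det_deformation:
  assumes t: "t \<in> {0..T}"
  shows "det (matrix (deformation t a)) = 1"
proof -
  define f where "f i \<tau> = deformation \<tau> a (axis i 1)" for i \<tau>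
  define \<Delta> where "\<Delta> \<tau> = f 1 \<tau> \<bullet> cross3 (f 2 \<tau>) (f 3 \<tau>)" for \<tau>
  have det: "det (matrix (deformation \<tau> a)) = \<Delta> \<tau>" for \<tau>
    by (simp add: \<Delta>_def f_def matrix_def cross3_simps)
  have "(\<Delta> has_vector_derivative 0) (at \<tau> within {0..T})" if \<tau>: "\<tau> \<in> {0..T}" for \<tau>
  proof -
    define A where "A = matrix (J \<tau> (X \<tau> a))"
    have A: "J \<tau> (X \<tau> a) h = A *v h" for h
      unfolding A_def by (simp add: matrix_works bounded_linear.linear[OF blinfun.bounded_linear_right])
    have f: "(f i has_vector_derivative A *v f i \<tau>) (at \<tau> within {0..T})" for i
      using deformation_apply_ode[OF \<tau>, of a "axis i 1"] by (simp add: f_def[abs_def] A)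
    have "trace A = 0"
      using incompressible[OF \<tau>, of "X \<tau> a"] by (simp add: trace_def A_def matrix_def)
    then show ?thesis
      unfolding \<Delta>_def
      by (rule_tac has_vector_derivative_eq_rhs[OF
            bounded_bilinear.has_vector_derivative[OF bounded_bilinear_inner f
              bounded_bilinear.has_vector_derivative[OF bounded_bilinear_cross3 f f]]])
        (use triple_product_rate[of A "f 1 \<tau>" "f 2 \<tau>" "f 3 \<tau>"] in \<open>simp add: inner_add_right algebra_simps\<close>)
  qed
  then obtain k where k: "\<And>\<tau>. \<tau> \<in> {0..T} \<Longrightarrow> \<Delta> \<tau> = k"
    using has_vector_derivative_zero_constant[of "{0..T}" \<Delta>] by (auto simp: convex_real_interval)
  have "\<Delta> 0 = 1"
    by (simp add: \<Delta>_def f_def deformation_start cross_basis inner_axis_axis)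
  then show ?thesis
    using k[of 0] k[OF t] T_pos by (simp add: det)
qed

lemma deformation_bij:
  assumes t: "t \<in> {0..T}"
  shows "bij (blinfun_apply (deformation t a))"
proof (rule bij_if_bilipschitz[of "2/3"])
  show "2/3 * norm (x - y) \<le> norm (deformation t a x - deformation t a y)" for x y
    using deformation_bounds(2)[OF t, of "x - y" a] by (simp add: blinfun.bilinear_simps)
qed (auto intro!: continuous_intros)

text \<open>Since \<open>F\<^sup>T (F b \<times> F c) = det F (b \<times> c)\<close> and \<open>det F = 1\<close>, conservation of the flux through all parallelograms
  says that the preimage of the absolute vorticity under \<open>F\<close> is constant in time.\<close>

lemma cauchy_vorticity_formula:
  assumes t: "t \<in> {0..T}"
  shows "deformation t a (curl (v 0) a + (2 * W) *\<^sub>R e3) = curl (v t) (X t a) + (2 * W) *\<^sub>R e3"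
proof -
  define A where "A = matrix (deformation t a)"
  have A: "deformation t a h = A *v h" for h
    unfolding A_def by (simp add: matrix_works bounded_linear.linear[OF blinfun.bounded_linear_right])
  have detA: "det A = 1"
    unfolding A_def by (rule det_deformation[OF t])
  obtain z where z: "curl (v t) (X t a) + (2 * W) *\<^sub>R e3 = deformation t a z"
    using deformation_bij[OF t, of a] by (meson bij_pointE)
  have "z \<bullet> cross3 b c = (curl (v 0) a + (2 * W) *\<^sub>R e3) \<bullet> cross3 b c" for b c
  proof -
    have "z \<bullet> cross3 b c = z \<bullet> (transpose A *v cross3 (A *v b) (A *v c))"
      by (simp only: cross_matrix_mult detA scaleR_one)
    also have "\<dots> = (A *v z) \<bullet> cross3 (A *v b) (A *v c)"
      using dot_lmul_matrix[of "cross3 (A *v b) (A *v c)" A z] by (simp add: inner_commute)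
    also have "\<dots> = (curl (v 0) a + (2 * W) *\<^sub>R e3) \<bullet> cross3 b c"
      using vorticity_flux_conserved[OF t, of a b c] by (simp add: z A)
    finally show ?thesis .
  qed
  then have "z = curl (v 0) a + (2 * W) *\<^sub>R e3"
    by (rule vector_eq_if_dot_cross_eq)
  with z show ?thesis by simp
qed

text \<open>The Cauchy formula solved for its terms of order \<open>W\<close>.\<close>

lemma axial_deformation:
  assumes t: "t \<in> {0..T}"
  shows "(2 * W) *\<^sub>R (deformation t a e3 - e3) = curl (v t) (X t a) - deformation t a (curl (v 0) a)"
  using cauchy_vorticity_formula[OF t, of a] by (simp add: blinfun.bilinear_simps algebra_simps)

lemma axial_deformation_bound:
  assumes t: "t \<in> {0..T}" and R: "\<And>t x. t \<in> {0..T} \<Longrightarrow> norm (curl (v t) x) \<le> R"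
  shows "norm (deformation t a e3 - e3) \<le> 7/6 * (R / W)"
proof -
  have R0: "norm (curl (v 0) a) \<le> R" using R[of 0 a] T_pos by simp
  have "2 * W * norm (deformation t a e3 - e3) = norm ((2 * W) *\<^sub>R (deformation t a e3 - e3))"
    using W_pos by simp
  also have "\<dots> \<le> norm (curl (v t) (X t a)) + norm (deformation t a (curl (v 0) a))"
    unfolding axial_deformation[OF t] by (rule norm_triangle_ineq4)
  also have "\<dots> \<le> R + 4/3 * R"
    using R[OF t, of "X t a"] deformation_bounds(1)[OF t, of a "curl (v 0) a"] R0 by linarith
  also have "\<dots> = 2 * W * (7/6 * (R / W))"
    using W_pos by (simp add: field_simps)
  finally show ?thesis
    using W_pos by (simp only: mult_le_cancel_left_pos)
qed

lemma inverse_flow_deriv: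
  assumes t: "t \<in> {0..T}"
  obtains B where "(inv (X t) has_derivative B) (at x)"
    and "\<And>h. B (deformation t (inv (X t) x) h) = h"
    and "\<And>h. norm (B h) \<le> 3/2 * norm h"
proof
  define a where "a = inv (X t) x"
  let ?F = "blinfun_apply (deformation t a)"
  have bij: "bij ?F" by (rule deformation_bij[OF t])
  have XA: "X t (inv (X t) y) = y" for y
    using flow_bij[OF t] by (simp add: bij_is_surj surj_f_inv_f)
  show BF: "inv ?F (deformation t (inv (X t) x) h) = h" for h
    unfolding a_def[symmetric] using bij by (simp add: bij_is_inj)
  show norm_inv: "norm (inv ?F h) \<le> 3/2 * norm h" for h
    using deformation_bounds(2)[OF t, of "inv ?F h" a] bij by (simp add: bij_is_surj surj_f_inv_f)
  have lin: "linear (inv ?F)"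
    using bij bounded_linear.linear[OF blinfun.bounded_linear_right] bij_is_surj bij_is_inj by (metis inj_linear_imp_inv_linear)
  show "(inv (X t) has_derivative inv ?F) (at x)"
  proof (rule has_derivative_inverse_basic[where f = "X t" and T = UNIV])
    show "(X t has_derivative ?F) (at (inv (X t) x))"
      using X_deriv[OF t] by (simp add: a_def)
    show "bounded_linear (inv ?F)"
      using lin by (simp add: linear_conv_bounded_linear)
    show "inv ?F \<circ> ?F = id"
      using bij by (simp add: bij_is_inj)
    have lip: "norm (inv (X t) y - inv (X t) x) \<le> 3/2 * norm (y - x)" for y
      using flow_lower[OF t, of "inv (X t) y" "inv (X t) x"] by (simp add: XA)
    have "((\<lambda>y. 3/2 * norm (y - x)) \<longlongrightarrow> 3/2 * norm (x - x)) (at x)"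
      by (intro tendsto_intros)
    then have lim: "((\<lambda>y. 3/2 * norm (y - x)) \<longlongrightarrow> 0) (at x)"
      by simp
    have "((\<lambda>y. inv (X t) y - inv (X t) x) \<longlongrightarrow> 0) (at x)"
      by (rule Lim_null_comparison[OF always_eventually[OF allI[OF lip]] lim])
    then show "continuous (at x) (inv (X t))"
      unfolding continuous_at by (rule LIM_zero_cancel)
  qed (auto simp: XA)
qed

lemma inverse_axial_bound:
  assumes t: "t \<in> {0..T}" and R: "\<And>t x. t \<in> {0..T} \<Longrightarrow> norm (curl (v t) x) \<le> R"
    and BF: "\<And>h. B (deformation t a h) = h"
    and B: "\<And>h. norm (B h) \<le> 3/2 * norm h"
  shows "norm (B e3 - e3) \<le> 7/4 * (R / W)"
proof -
  have "B h - B k = B (h - k)" for h k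
  proof -
    obtain h' k' where "h = deformation t a h'" "k = deformation t a k'"
      using deformation_bij[OF t, of a] by (meson bij_pointE)
    then show ?thesis by (simp add: BF flip: blinfun.diff_right)
  qed
  then have "e3 - B e3 = B (deformation t a e3 - e3)"
    using BF[of e3] by metis
  then have "norm (B e3 - e3) \<le> 3/2 * norm (deformation t a e3 - e3)"
    using B[of "deformation t a e3 - e3"] by (simp add: norm_minus_commute)
  also have "\<dots> \<le> 3/2 * (7/6 * (R / W))"
    using axial_deformation_bound[OF t R, of a] by simp
  also have "\<dots> = 7/4 * (R / W)"
    by simp
  finally show ?thesis .
qed

lemma axial_rigidity:
  assumes t: "t \<in> {0..T}" and R: "\<And>t x. t \<in> {0..T} \<Longrightarrow> norm (curl (v t) x) \<le> R"
  shows "norm (X t (a + s *\<^sub>R e3) - X t a - s *\<^sub>R e3) \<le> \<bar>s\<bar> * (7/6 * (R / W))"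
proof -
  define d where "d s = X t (a + s *\<^sub>R e3) - s *\<^sub>R e3" for s
  have "norm (d s - d 0) \<le> 7/6 * (R / W) * norm (s - 0)"
  proof (rule differentiable_bound[of UNIV])
    fix s :: real
    let ?d = "deformation t (a + s *\<^sub>R e3) e3 - e3"
    have line: "((\<lambda>s. a + s *\<^sub>R e3) has_derivative (\<lambda>h. h *\<^sub>R e3)) (at s)"
      by (auto intro!: derivative_eq_intros)
    have "(d has_derivative (\<lambda>h. h *\<^sub>R ?d)) (at s)"
      unfolding d_def
      by (rule has_derivative_eq_rhs[OF has_derivative_diff[OF has_derivative_compose[OF line X_deriv[OF t]]
              has_derivative_scaleR_left[OF has_derivative_ident]]])
        (simp add: blinfun.bilinear_simps algebra_simps)
    then show "(d has_derivative (\<lambda>h. h *\<^sub>R ?d)) (at s within UNIV)" by simp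
    show "onorm (\<lambda>h. h *\<^sub>R ?d) \<le> 7/6 * (R / W)"
      using axial_deformation_bound[OF t R, of "a + s *\<^sub>R e3"] onorm_scaleR_left[of "\<lambda>h::real. h" ?d]
      by (simp add: onorm_id)
  qed auto
  then show ?thesis by (simp add: d_def algebra_simps)
qed

end

section \<open>Periodicity and a bound on the velocity\<close>

lemma spatially_periodic_int:
  assumes "spatially_periodic L f"
  shows "f (x + (of_int m * L $ i) *\<^sub>R axis i 1) = f x"
proof -
  have nat: "f (x + (of_nat k * L $ i) *\<^sub>R axis i 1) = f x" for k x
  proof (induction k)
    case (Suc k)
    have "f (x + (of_nat (Suc k) * L $ i) *\<^sub>R axis i 1)
        = f ((x + (of_nat k * L $ i) *\<^sub>R axis i 1) + (L $ i) *\<^sub>R axis i 1)"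
      by (simp add: algebra_simps)
    also have "\<dots> = f x"
      using assms Suc unfolding spatially_periodic_def by simp
    finally show ?case .
  qed simp
  show ?thesis
  proof (cases "0 \<le> m")
    case True
    then show ?thesis using nat[of x "nat m"] by simp
  next
    case False
    then show ?thesis
      using nat[of "x + (of_int m * L $ i) *\<^sub>R axis i 1" "nat (- m)"] by simp
  qed
qed

text \<open>Three coordinate shifts move \<open>x\<close> into the period cell.\<close>

lemma spatially_periodic_representative:
  assumes f: "spatially_periodic L f" and L: "\<forall>i. 0 < L $ i"
  obtains y where "y \<in> cbox 0 L" "f y = f x"
proof -
  define m where "m i = - \<lfloor>x $ i / L $ i\<rfloor>" for i
  define y where "y = x + (of_int (m 1) * L $ 1) *\<^sub>R axis 1 1
    + (of_int (m 2) * L $ 2) *\<^sub>R axis 2 1 + (of_int (m 3) * L $ 3) *\<^sub>R axis 3 1"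
  have "f y = f x"
    unfolding y_def by (simp only: spatially_periodic_int[OF f])
  moreover have "0 \<le> y $ i \<and> y $ i \<le> L $ i" for i
  proof -
    have Li: "0 < L $ i" using L by simp
    have "y $ i = x $ i - of_int \<lfloor>x $ i / L $ i\<rfloor> * L $ i"
      using exhaust_3[of i] by (auto simp: y_def m_def axis_def)
    moreover have "of_int \<lfloor>x $ i / L $ i\<rfloor> * L $ i \<le> x $ i"
      using floor_divide_lower[OF Li] .
    moreover have "x $ i \<le> (of_int \<lfloor>x $ i / L $ i\<rfloor> + 1) * L $ i"
      using floor_divide_upper[OF Li] by (rule less_imp_le)
    ultimately show ?thesis by (simp add: algebra_simps)
  qed
  then have "y \<in> cbox 0 L"
    by (simp add: mem_box_cart)
  ultimately show thesis
    using that by blast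
qed

text \<open>Averages over the points of a fine uniform grid stand in for spatial means over the period cell; a
  shift by one mesh width permutes the grid modulo the periods.\<close>

definition grid_index :: "nat \<Rightarrow> (3 \<Rightarrow> nat) set"
  where "grid_index n = UNIV \<rightarrow>\<^sub>E {..<n}"

definition grid_point :: "real^3 \<Rightarrow> nat \<Rightarrow> (3 \<Rightarrow> nat) \<Rightarrow> real^3"
  where "grid_point L n k = (\<chi> i. real (k i) / real n * L $ i)"

lemma mem_grid_index: "k \<in> grid_index n \<longleftrightarrow> (\<forall>i. k i < n)"
  by (auto simp: grid_index_def PiE_def Pi_def)

lemma finite_grid_index: "finite (grid_index n)"
  unfolding grid_index_def by (rule finite_PiE) auto

lemma grid_index_nonempty: "0 < n \<Longrightarrow> grid_index n \<noteq> {}"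
  unfolding grid_index_def by (auto simp: PiE_eq_empty_iff)

lemma grid_point_in_box:
  assumes "\<forall>i. 0 < L $ i" "k \<in> grid_index n"
  shows "0 \<le> grid_point L n k $ i" "grid_point L n k $ i \<le> L $ i"
proof -
  have "k i < n" using assms(2) by (simp add: mem_grid_index)
  then have "real (k i) / real n \<le> 1" by simp
  then show "0 \<le> grid_point L n k $ i" "grid_point L n k $ i \<le> L $ i"
    using assms(1) mult_right_mono[of "real (k i) / real n" 1 "L $ i"]
    by (auto simp: grid_point_def less_imp_le)
qed

lemma grid_sum_shift:
  fixes f :: "real^3 \<Rightarrow> 'b::comm_monoid_add"
  assumes f: "\<And>x. f (x + (L $ j) *\<^sub>R axis j 1) = f x" and n: "0 < n"
  shows "(\<Sum>k\<in>grid_index n. f (grid_point L n k + (L $ j / n) *\<^sub>R axis j 1))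
    = (\<Sum>k\<in>grid_index n. f (grid_point L n k))"
proof -
  define \<sigma> where "\<sigma> k = k(j := (if k j + 1 = n then 0 else k j + 1))" for k :: "3 \<Rightarrow> nat"
  have lt: "k i < n" if "k \<in> grid_index n" for k i
    using that by (simp add: mem_grid_index)
  have maps: "\<sigma> ` grid_index n \<subseteq> grid_index n"
  proof (rule image_subsetI)
    fix k assume "k \<in> grid_index n"
    then show "\<sigma> k \<in> grid_index n"
      using n lt[of k] lt[of k j] by (auto simp: mem_grid_index \<sigma>_def intro!: Suc_lessI)
  qed
  have "inj_on \<sigma> (grid_index n)"
  proof (rule inj_onI, rule ext)
    fix k l i assume "k \<in> grid_index n" "l \<in> grid_index n" and eq: "\<sigma> k = \<sigma> l"
    show "k i = l i"
      using fun_cong[OF eq, of i] by (auto simp: \<sigma>_def split: if_splits)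
  qed
  then have "bij_betw \<sigma> (grid_index n) (grid_index n)"
    using endo_inj_surj[OF finite_grid_index maps] by (auto simp: bij_betw_def)
  then have "(\<Sum>k\<in>grid_index n. f (grid_point L n (\<sigma> k))) = (\<Sum>k\<in>grid_index n. f (grid_point L n k))"
    by (rule sum.reindex_bij_betw)
  moreover have "f (grid_point L n (\<sigma> k)) = f (grid_point L n k + (L $ j / n) *\<^sub>R axis j 1)"
    if k: "k \<in> grid_index n" for k
  proof (cases "k j + 1 = n")
    case False
    then have "grid_point L n (\<sigma> k) = grid_point L n k + (L $ j / n) *\<^sub>R axis j 1"
      using n by (auto simp: vec_eq_iff grid_point_def \<sigma>_def axis_def field_simps)
    then show ?thesis by simp
  next
    case True
    then have "real n = real (k j) + 1" by linarith
    then have "grid_point L n (\<sigma> k) + (L $ j) *\<^sub>R axis j 1 = grid_point L n k + (L $ j / n) *\<^sub>R axis j 1"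
      using n True by (auto simp: vec_eq_iff grid_point_def \<sigma>_def axis_def field_simps)
    then show ?thesis using f[of "grid_point L n (\<sigma> k)"] by simp
  qed
  ultimately show ?thesis by (simp cong: sum.cong)
qed

text \<open>A discrete form of the vanishing of the mean of a derivative of a periodic function. The sum of the increments of \<open>f\<close> over
  one mesh width is zero by shift invariance, and each increment is the mesh width times \<open>E\<close>, up to the oscillation of \<open>E\<close>.\<close>

lemma grid_sum_derivative_small:
  fixes f E :: "real^3 \<Rightarrow> 'b::real_normed_vector" and \<epsilon> :: real
  assumes f: "\<And>x. f (x + (L $ j) *\<^sub>R axis j 1) = f x" and n: "0 < n" and L: "0 < L $ j"
    and deriv: "\<And>x s. ((\<lambda>s. f (x + s *\<^sub>R axis j 1)) has_vector_derivative E (x + s *\<^sub>R axis j 1)) (at s)"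
    and osc: "\<And>k s. k \<in> grid_index n \<Longrightarrow> 0 \<le> s \<Longrightarrow> s \<le> L $ j / n \<Longrightarrow>
      norm (E (grid_point L n k + s *\<^sub>R axis j 1) - E (grid_point L n k)) \<le> \<epsilon>"
  shows "norm (\<Sum>k\<in>grid_index n. E (grid_point L n k)) \<le> card (grid_index n) * \<epsilon>"
proof -
  define h where "h = L $ j / n"
  have h: "0 < h" using n L by (simp add: h_def)
  let ?K = "grid_index n" and ?g = "grid_point L n"
  have step: "norm (f (?g k + h *\<^sub>R axis j 1) - f (?g k) - h *\<^sub>R E (?g k)) \<le> h * \<epsilon>" if k: "k \<in> ?K" for k
  proof -
    have "norm (f (?g k + h *\<^sub>R axis j 1) - f (?g k + 0 *\<^sub>R axis j 1) - (h - 0) *\<^sub>R E (?g k + 0 *\<^sub>R axis j 1)) \<le> norm (h - 0) * \<epsilon>"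
    proof (rule vector_differentiable_bound_linearization[where S = "{0..h}" and f' = "\<lambda>s. E (?g k + s *\<^sub>R axis j 1)"])
      show "closed_segment 0 h \<subseteq> {0..h}" using h by (simp add: closed_segment_eq_real_ivl)
      show "((\<lambda>s. f (?g k + s *\<^sub>R axis j 1)) has_vector_derivative E (?g k + s *\<^sub>R axis j 1))
          (at s within {0..h})" for s
        by (rule has_vector_derivative_at_within[OF deriv])
    qed (use h osc[OF k] in \<open>auto simp: h_def\<close>)
    then show ?thesis using h by simp
  qed
  have "(\<Sum>k\<in>?K. f (?g k + h *\<^sub>R axis j 1) - f (?g k)) = 0"
    using grid_sum_shift[where f = f and L = L and j = j, OF f n] by (simp add: sum_subtractf h_def)
  then have "h *\<^sub>R (\<Sum>k\<in>?K. E (?g k)) = - (\<Sum>k\<in>?K. f (?g k + h *\<^sub>R axis j 1) - f (?g k) - h *\<^sub>R E (?g k))"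
    by (simp add: sum_subtractf scaleR_sum_right)
  from arg_cong[OF this, of norm]
  have "h * norm (\<Sum>k\<in>?K. E (?g k)) = norm (\<Sum>k\<in>?K. f (?g k + h *\<^sub>R axis j 1) - f (?g k) - h *\<^sub>R E (?g k))"
    using h unfolding norm_minus_cancel norm_scaleR by simp
  also have "\<dots> \<le> (\<Sum>k\<in>?K. h * \<epsilon>)"
    by (rule order_trans[OF norm_sum sum_mono]) (rule step)
  also have "\<dots> = h * (card ?K * \<epsilon>)" by simp
  finally show ?thesis using h by (simp only: mult_le_cancel_left_pos)
qed

locale periodic_rotating_flow = rotating_flow T M v J X W v\<^sub>t p P
  for T M v J X W v\<^sub>t p P +
  fixes L :: "real^3"
  assumes L_pos: "\<forall>i. 0 < L $ i"
    and v_periodic: "\<And>t. t \<in> {0..T} \<Longrightarrow> spatially_periodic L (v t)"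
    and p_periodic: "\<And>t. t \<in> {0..T} \<Longrightarrow> spatially_periodic L (p t)"
begin

text \<open>A path shifted by a period is again a path, and paths are determined by their starting point.\<close>

lemma displacement_periodic:
  assumes t: "t \<in> {0..T}"
  shows "spatially_periodic L (\<lambda>a. X t a - a)"
  unfolding spatially_periodic_def
proof (intro allI)
  fix i a
  let ?l = "(L $ i) *\<^sub>R axis i 1 :: real^3"
  have "norm (X t (a + ?l) - (X t a + ?l)) \<le> 4/3 * norm (X 0 (a + ?l) - (X 0 a + ?l))"
  proof (rule solutions_stay_close(1)[OF X_ode _ t])
    fix t assume t: "t \<in> {0..T}"
    have "v t (X t a + ?l) = v t (X t a)"
      using v_periodic[OF t] unfolding spatially_periodic_def by blast
    then show "((\<lambda>t. X t a + ?l) has_vector_derivative v t (X t a + ?l)) (at t within {0..T})"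
      using has_vector_derivative_add[OF X_ode[OF t] has_vector_derivative_const] by simp
  qed
  then show "X t (a + ?l) - (a + ?l) = X t a - a"
    by (simp add: X_start)
qed

text \<open>The momentum flux in direction \<open>j\<close>: column \<open>j\<close> of the tensor \<open>v \<otimes> v + p I\<close>, whose divergence is the sum
  of advection and pressure gradient.\<close>

definition flux :: "3 \<Rightarrow> real \<Rightarrow> real^3 \<Rightarrow> real^3"
  where "flux j t x = (v t x $ j) *\<^sub>R v t x + p t x *\<^sub>R axis j 1"

definition flux_rate :: "3 \<Rightarrow> real \<Rightarrow> real^3 \<Rightarrow> real^3"
  where "flux_rate j t x = (v t x $ j) *\<^sub>R J t x (axis j 1) + (J t x (axis j 1) $ j) *\<^sub>R v t x
    + (P t x $ j) *\<^sub>R axis j 1"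

lemma flux_deriv:
  assumes t: "t \<in> {0..T}"
  shows "((\<lambda>s. flux j t (x + s *\<^sub>R axis j 1)) has_vector_derivative flux_rate j t (x + s *\<^sub>R axis j 1)) (at s)"
proof -
  let ?y = "x + s *\<^sub>R axis j 1"
  have line: "((\<lambda>s. x + s *\<^sub>R axis j 1) has_derivative (\<lambda>h. h *\<^sub>R axis j 1)) (at s)"
    by (auto intro!: derivative_eq_intros)
  have dv: "((\<lambda>s. v t (x + s *\<^sub>R axis j 1)) has_derivative (\<lambda>h. h *\<^sub>R J t ?y (axis j 1))) (at s)"
    using has_derivative_compose[OF line v_deriv[OF t]] by (simp add: blinfun.bilinear_simps)
  have dp: "((\<lambda>s. p t (x + s *\<^sub>R axis j 1)) has_derivative (\<lambda>h. h * P t ?y $ j)) (at s)"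
    using has_derivative_compose[OF line p_deriv[OF t]] by (simp add: inner_axis)
  have dvj: "((\<lambda>s. v t (x + s *\<^sub>R axis j 1) $ j) has_derivative (\<lambda>h. h * J t ?y (axis j 1) $ j)) (at s)"
    using bounded_linear.has_derivative[OF bounded_linear_vec_nth dv] by simp
  show ?thesis
    unfolding flux_def has_vector_derivative_def
    by (rule has_derivative_eq_rhs[OF has_derivative_add[OF has_derivative_scaleR[OF dvj dv]
            has_derivative_scaleR[OF dp has_derivative_const]]])
      (simp add: fun_eq_iff flux_rate_def algebra_simps)
qed

lemma flux_periodic:
  assumes t: "t \<in> {0..T}"
  shows "flux j t (x + (L $ j) *\<^sub>R axis j 1) = flux j t x"
  using v_periodic[OF t] p_periodic[OF t] unfolding spatially_periodic_def flux_def by simp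

lemma flux_rate_sum:
  assumes t: "t \<in> {0..T}"
  shows "v\<^sub>t t x = - (\<Sum>j\<in>UNIV. flux_rate j t x) - (2 * W) *\<^sub>R cross3 e3 (v t x)"
proof -
  have "(\<Sum>j\<in>UNIV. (v t x $ j) *\<^sub>R J t x (axis j 1)) = J t x (v t x)"
  proof -
    have "J t x (v t x) = J t x (\<Sum>j\<in>UNIV. (v t x $ j) *\<^sub>R axis j 1)"
      by (simp add: basis_expansion flip: scalar_mult_eq_scaleR)
    then show ?thesis
      by (simp add: blinfun.sum_right blinfun.scaleR_right)
  qed
  moreover have "(\<Sum>j\<in>UNIV. (J t x (axis j 1) $ j) *\<^sub>R v t x) = 0"
    using incompressible[OF t, of x] by (simp flip: scaleR_sum_left)
  moreover have "(\<Sum>j\<in>UNIV. (P t x $ j) *\<^sub>R axis j 1) = P t x"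
    by (simp add: basis_expansion flip: scalar_mult_eq_scaleR)
  ultimately have "(\<Sum>j\<in>UNIV. flux_rate j t x) = J t x (v t x) + P t x"
    by (simp add: flux_rate_def sum.distrib)
  then show ?thesis
    using P_eq[OF t, of x] by simp
qed

lemma continuous_on_flux_rate: "continuous_on ({0..T} \<times> UNIV) (\<lambda>z. flux_rate j (fst z) (snd z))"
  unfolding flux_rate_def by (intro continuous_intros) auto

text \<open>Uniform continuity of the three flux derivatives on a compact set provides one mesh that works
  for all times and all directions.\<close>

lemma grid_flux_small:
  fixes \<epsilon> :: real
  assumes \<epsilon>: "0 < \<epsilon>"
  obtains n where "0 < n" "\<And>t j. t \<in> {0..T} \<Longrightarrow>
    norm (\<Sum>k\<in>grid_index n. flux_rate j t (grid_point L n k)) \<le> card (grid_index n) * \<epsilon>"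
proof -
  let ?C = "{0..T} \<times> cbox 0 (2 *\<^sub>R L)"
  have "\<forall>j. \<exists>\<delta>>0. \<forall>z\<in>?C. \<forall>z'\<in>?C. dist z' z < \<delta> \<longrightarrow>
      dist (flux_rate j (fst z') (snd z')) (flux_rate j (fst z) (snd z)) < \<epsilon>"
  proof
    fix j
    have "uniformly_continuous_on ?C (\<lambda>z. flux_rate j (fst z) (snd z))"
      by (rule compact_uniformly_continuous)
        (auto intro!: compact_Times continuous_on_subset[OF continuous_on_flux_rate])
    then show "\<exists>\<delta>>0. \<forall>z\<in>?C. \<forall>z'\<in>?C. dist z' z < \<delta> \<longrightarrow>
        dist (flux_rate j (fst z') (snd z')) (flux_rate j (fst z) (snd z)) < \<epsilon>"
      using \<epsilon> unfolding uniformly_continuous_on_def by (elim allE[of _ \<epsilon>] impE)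
  qed
  from choice[OF this] obtain \<delta> where \<delta>': "\<forall>j. 0 < \<delta> j \<and> (\<forall>z\<in>?C. \<forall>z'\<in>?C. dist z' z < \<delta> j \<longrightarrow>
      dist (flux_rate j (fst z') (snd z')) (flux_rate j (fst z) (snd z)) < \<epsilon>)" ..
  then have \<delta>: "0 < \<delta> j" for j by blast
  have unif: "dist (flux_rate j (fst z') (snd z')) (flux_rate j (fst z) (snd z)) < \<epsilon>"
    if "z \<in> ?C" "z' \<in> ?C" "dist z' z < \<delta> j" for j z z'
    using \<delta>' that by blast
  define n where "n = Suc (nat \<lceil>Max (range (\<lambda>j. L $ j / \<delta> j))\<rceil>)"
  have mesh: "L $ j / n < \<delta> j" for j
  proof -
    have "L $ j / \<delta> j \<le> Max (range (\<lambda>j. L $ j / \<delta> j))"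
      by (intro Max_ge) auto
    also have "\<dots> < n" unfolding n_def by linarith
    finally show ?thesis using \<delta>[of j] by (simp add: n_def field_simps)
  qed
  show thesis
  proof (rule that[of n])
    show n: "0 < n" by (simp add: n_def)
    fix t j assume t: "t \<in> {0..T}"
    show "norm (\<Sum>k\<in>grid_index n. flux_rate j t (grid_point L n k)) \<le> card (grid_index n) * \<epsilon>"
    proof (rule grid_sum_derivative_small[OF flux_periodic[OF t] n _ flux_deriv[OF t]])
      show "0 < L $ j" using L_pos by simp
      fix k s assume k: "k \<in> grid_index n" and s: "0 \<le> s" "s \<le> L $ j / n"
      let ?x = "grid_point L n k"
      have Lj: "L $ j / n \<le> L $ j"
        using n L_pos[rule_format, of j] by (simp add: divide_le_eq)
      have "0 \<le> ?x $ i \<and> ?x $ i \<le> 2 * L $ i \<and> 0 \<le> (?x + s *\<^sub>R axis j 1) $ i \<and> (?x + s *\<^sub>R axis j 1) $ i \<le> 2 * L $ i" for i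
        using grid_point_in_box[OF L_pos k, of i] s Lj L_pos[rule_format, of i] by (auto simp: axis_def)
      then have "(t, ?x) \<in> ?C" "(t, ?x + s *\<^sub>R axis j 1) \<in> ?C"
        using t by (auto simp: mem_box_cart)
      moreover have "dist (t, ?x + s *\<^sub>R axis j 1) (t, ?x) < \<delta> j"
        using s mesh[of j] by (simp add: dist_Pair_Pair dist_norm)
      ultimately show "norm (flux_rate j t (?x + s *\<^sub>R axis j 1) - flux_rate j t ?x) \<le> \<epsilon>"
        using unif[of "(t, ?x)" "(t, ?x + s *\<^sub>R axis j 1)" j] by (simp add: dist_norm)
    qed
  qed
qed

text \<open>The grid sum \<open>S\<close> of the velocity satisfies \<open>S' = - r - 2W e\<^sub>3 \<times> S\<close> with \<open>r\<close> small. The Coriolis term is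
  orthogonal to \<open>S\<close>, so \<open>|S|\<close> hardly grows, whatever \<open>W\<close> is. From the grid average the velocity differs by
  at most \<open>M\<close> times the diameter of the period cell.\<close>

lemma velocity_bound:
  assumes t: "t \<in> {0..T}" and V0: "\<And>x. norm (v 0 x) \<le> V0"
  shows "norm (v t x) \<le> V0 + 1 + M * norm L"
proof -
  \<comment> \<open>Three directions and the factor 2 from differentiating \<open>S \<bullet> S\<close> make the growth of the average at most \<open>1\<close> over time \<open>T\<close>.\<close>
  define \<epsilon> where "\<epsilon> = 1 / (6 * T)"
  have \<epsilon>: "0 < \<epsilon>" using T_pos by (simp add: \<epsilon>_def)
  obtain n where n: "0 < n" and small: "\<And>t j. t \<in> {0..T} \<Longrightarrow>
      norm (\<Sum>k\<in>grid_index n. flux_rate j t (grid_point L n k)) \<le> card (grid_index n) * \<epsilon>"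
    using grid_flux_small[OF \<epsilon>] by blast
  let ?K = "grid_index n" and ?g = "grid_point L n"
  define c where "c = real (card ?K)"
  have c: "0 < c"
    unfolding c_def using finite_grid_index grid_index_nonempty[OF n] by (simp add: card_gt_0_iff)
  define S where "S t = (\<Sum>k\<in>?K. v t (?g k))" for t
  define r where "r t = (\<Sum>j\<in>UNIV. \<Sum>k\<in>?K. flux_rate j t (?g k))" for t
  have r: "norm (r t) \<le> 3 * c * \<epsilon>" if t: "t \<in> {0..T}" for t
  proof -
    have "norm (r t) \<le> (\<Sum>j\<in>(UNIV::3 set). c * \<epsilon>)"
      unfolding r_def c_def by (intro order_trans[OF norm_sum sum_mono] small t)
    then show ?thesis by simp
  qed
  have S_ode: "(S has_vector_derivative - r t - (2 * W) *\<^sub>R cross3 e3 (S t)) (at t within {0..T})"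
    if t: "t \<in> {0..T}" for t
  proof -
    have "(S has_vector_derivative (\<Sum>k\<in>?K. v\<^sub>t t (?g k))) (at t within {0..T})"
      unfolding S_def by (intro has_vector_derivative_sum v_time t)
    moreover have "(\<Sum>k\<in>?K. v\<^sub>t t (?g k)) = - r t - (2 * W) *\<^sub>R cross3 e3 (S t)"
      unfolding r_def S_def
      by (subst sum.swap) (simp add: flux_rate_sum[OF t] sum_subtractf sum_negf
          linear_sum[OF bounded_linear.linear[OF bounded_linear_cross3]] scaleR_sum_right)
    ultimately show ?thesis by simp
  qed
  have S_cont: "continuous_on {0..T} S"
    using S_ode has_vector_derivative_continuous continuous_on_eq_continuous_within by blast
  then have "continuous_on {0..T} (\<lambda>t. norm (S t))"
    by (intro continuous_intros)
  then obtain \<tau> where \<tau>: "\<tau> \<in> {0..T}" and max: "\<And>t. t \<in> {0..T} \<Longrightarrow> norm (S t) \<le> norm (S \<tau>)"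
    using continuous_attains_sup[of "{0..T}" "\<lambda>t. norm (S t)"] T_pos by auto
  define m where "m = norm (S \<tau>)"
  have energy: "((\<lambda>t. S t \<bullet> S t) has_vector_derivative - 2 * (S t \<bullet> r t)) (at t within {0..T})"
    if t: "t \<in> {0..T}" for t
    using bounded_bilinear.has_vector_derivative[OF bounded_bilinear_inner S_ode[OF t] S_ode[OF t]]
    by (simp add: inner_diff_left inner_diff_right inner_minus_left inner_minus_right
        dot_cross_self inner_commute[of "cross3 e3 (S t)"] inner_commute[of "r t"])
  have "norm (S \<tau> \<bullet> S \<tau> - S 0 \<bullet> S 0) \<le> 6 * c * \<epsilon> * m * norm (\<tau> - 0)"
  proof (rule differentiable_bound[of "{0..T}"])
    fix t assume t: "t \<in> {0..T}"
    show "((\<lambda>t. S t \<bullet> S t) has_derivative (\<lambda>h. h *\<^sub>R (- 2 * (S t \<bullet> r t)))) (at t within {0..T})"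
      using energy[OF t] by (simp only: has_vector_derivative_def)
    have "\<bar>S t \<bullet> r t\<bar> \<le> m * (3 * c * \<epsilon>)"
      by (rule order_trans[OF Cauchy_Schwarz_ineq2 mult_mono])
        (use max[OF t] r[OF t] in \<open>auto simp: m_def\<close>)
    then have "norm (- 2 * (S t \<bullet> r t)) \<le> 6 * c * \<epsilon> * m"
      by (simp add: abs_mult mult_ac)
    then show "onorm (\<lambda>h. h *\<^sub>R (- 2 * (S t \<bullet> r t))) \<le> 6 * c * \<epsilon> * m"
      using onorm_scaleR_left[of "\<lambda>h::real. h" "- 2 * (S t \<bullet> r t)"] by (simp add: onorm_id)
  qed (use \<tau> T_pos in auto)
  also have "\<dots> \<le> 6 * c * \<epsilon> * m * T"
    using \<tau> c \<epsilon> by (intro mult_left_mono) (auto simp: m_def)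
  also have "\<dots> = c * m"
    using T_pos by (simp add: \<epsilon>_def)
  finally have "m\<^sup>2 \<le> (norm (S 0))\<^sup>2 + c * m"
    by (simp add: m_def power2_norm_eq_inner)
  also have "(norm (S 0))\<^sup>2 \<le> norm (S 0) * m"
    using max[of 0] T_pos by (simp add: power2_eq_square m_def mult_left_mono)
  finally have "m * m \<le> (norm (S 0) + c) * m"
    by (simp add: power2_eq_square algebra_simps)
  then have "m \<le> norm (S 0) + c"
    using c by (cases "m = 0") (auto simp: m_def)
  moreover have "norm (S 0) \<le> c * V0"
  proof -
    have "norm (S 0) \<le> (\<Sum>k\<in>?K. V0)"
      unfolding S_def by (intro order_trans[OF norm_sum sum_mono] V0)
    then show ?thesis by (simp add: c_def)
  qed
  ultimately have S: "norm (S t) \<le> c * (V0 + 1)"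
    using max[OF t] by (simp add: m_def algebra_simps)
  obtain y where y: "y \<in> cbox 0 L" and vy: "v t y = v t x"
    using spatially_periodic_representative[OF v_periodic[OF t] L_pos] by blast
  have near: "norm (v t y - v t (?g k)) \<le> M * norm L" if k: "k \<in> ?K" for k
  proof -
    have "norm (y - ?g k) \<le> norm L"
    proof (rule norm_le_componentwise_cart)
      fix i
      have "0 \<le> y $ i" "y $ i \<le> L $ i" using y by (auto simp: mem_box_cart)
      then show "norm ((y - ?g k) $ i) \<le> norm (L $ i)"
        using grid_point_in_box[OF L_pos k, of i] by (auto simp: abs_le_iff)
    qed
    then show ?thesis
      using v_lipschitz[OF t, of y "?g k"] mult_left_mono[OF _ M_nonneg] by fastforce
  qed
  have "c *\<^sub>R v t y = S t + (\<Sum>k\<in>?K. v t y - v t (?g k))"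
    by (simp add: S_def c_def sum_subtractf sum_constant_scaleR del: sum_constant)
  from arg_cong[OF this, of norm]
  have "c * norm (v t y) = norm (S t + (\<Sum>k\<in>?K. v t y - v t (?g k)))"
    using c unfolding norm_scaleR by simp
  also have "\<dots> \<le> c * (V0 + 1) + (\<Sum>k\<in>?K. M * norm L)"
    by (intro norm_triangle_mono S order_trans[OF norm_sum sum_mono] near)
  also have "\<dots> = c * (V0 + 1 + M * norm L)"
    by (simp add: c_def algebra_simps)
  finally show ?thesis
    using c vy by simp
qed

lemma X_time_lipschitz:
  assumes s: "s \<in> {0..T}" and t: "t \<in> {0..T}" and V0: "\<And>x. norm (v 0 x) \<le> V0"
  shows "norm (X t a - X s a) \<le> (V0 + 1 + M * norm L) * \<bar>t - s\<bar>"
proof -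
  have "norm (X t a - X s a) \<le> (V0 + 1 + M * norm L) * norm (t - s)"
  proof (rule differentiable_bound[of "{0..T}"])
    fix t assume t: "t \<in> {0..T}"
    show "((\<lambda>\<tau>. X \<tau> a) has_derivative (\<lambda>h. h *\<^sub>R v t (X t a))) (at t within {0..T})"
      using X_ode[OF t] by (simp only: has_vector_derivative_def)
    show "onorm (\<lambda>h. h *\<^sub>R v t (X t a)) \<le> V0 + 1 + M * norm L"
      using velocity_bound[OF t V0, of "X t a"] onorm_scaleR_left[of "\<lambda>h::real. h" "v t (X t a)"]
      by (simp add: onorm_id)
  qed (use s t in auto)
  then show ?thesis by simp
qed

end

section \<open>Compactness of families of flows\<close>

text \<open>All properties of the limit are inequalities and equations that pass to pointwise limits. Vertical rigidity becomes
  exact because its defect \<open>c j\<close> tends to zero, so the limiting displacement depends on the horizontal labels only.\<close>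

lemma subsequential_limit_of_flows:
  fixes Xs :: "nat \<Rightarrow> real \<Rightarrow> real^3 \<Rightarrow> real^3"
  assumes L: "\<forall>i. 0 < L $ i" and T: "0 < T"
    and start: "\<And>j a. Xs j 0 a = a"
    and upper: "\<And>j t a b. t \<in> {0..T} \<Longrightarrow> norm (Xs j t a - Xs j t b) \<le> 4/3 * norm (a - b)"
    and lower: "\<And>j t a b. t \<in> {0..T} \<Longrightarrow> 2/3 * norm (a - b) \<le> norm (Xs j t a - Xs j t b)"
    and speed: "\<And>j s t a. s \<in> {0..T} \<Longrightarrow> t \<in> {0..T} \<Longrightarrow> norm (Xs j t a - Xs j s a) \<le> B * \<bar>t - s\<bar>"
    and periodic: "\<And>j t. t \<in> {0..T} \<Longrightarrow> spatially_periodic L (\<lambda>a. Xs j t a - a)"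
    and rigid: "\<And>j t a s. t \<in> {0..T} \<Longrightarrow> norm (Xs j t (a + s *\<^sub>R e3) - Xs j t a - s *\<^sub>R e3) \<le> \<bar>s\<bar> * c j"
    and c: "c \<longlonglongrightarrow> 0"
  shows "\<exists>(r :: nat \<Rightarrow> nat) (Y :: real \<Rightarrow> real^3 \<Rightarrow> real^3) (lam :: real \<Rightarrow> real \<Rightarrow> real \<Rightarrow> real^3).
          strict_mono r \<and>
          uniform_limit ({0..T} \<times> UNIV) (\<lambda>j (t, a). Xs (r j) t a) (\<lambda>(t, a). Y t a) sequentially \<and>
          (\<forall>t\<in>{0..T}. bij (Y t)) \<and>
          (\<forall>t\<in>{0..T}. \<forall>a1 a2. lam (a1 + L $ 1) a2 t = lam a1 a2 t \<and> lam a1 (a2 + L $ 2) t = lam a1 a2 t) \<and>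
          (\<forall>t\<in>{0..T}. \<forall>a. Y t a = a + lam (a $ 1) (a $ 2) t)"
proof -
  let ?S = "{0..T} \<times> cbox 0 L"
  have "norm (Xs 0 T 0 - Xs 0 0 0) \<le> B * T"
    using speed[of 0 T 0 0] T by simp
  then have "0 \<le> B * T"
    by (rule order_trans[OF norm_ge_zero])
  then have B: "0 \<le> B"
    using T by (simp add: zero_le_mult_iff)
  obtain g and r :: "nat \<Rightarrow> nat" where r: "strict_mono r"
    and conv: "\<And>e. 0 < e \<Longrightarrow> \<exists>K. \<forall>n z. n \<ge> K \<and> z \<in> ?S \<longrightarrow> norm (Xs (r n) (fst z) (snd z) - g z) < e"
  proof (rule Arzela_Ascoli[of ?S "\<lambda>n z. Xs n (fst z) (snd z)" "norm L + B * T"])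
    show "compact ?S" by (intro compact_Times) auto
    show "norm (Xs n (fst z) (snd z)) \<le> norm L + B * T" if z: "z \<in> ?S" for n z
    proof -
      have t: "fst z \<in> {0..T}" "snd z \<in> cbox 0 L" using z by auto
      have "norm (snd z) \<le> norm L"
        using t(2) by (intro norm_le_componentwise_cart) (auto simp: mem_box_cart abs_le_iff intro: order_trans)
      moreover have "norm (Xs n (fst z) (snd z) - snd z) \<le> B * T"
        using speed[of 0 "fst z" n "snd z"] t T mult_left_mono[OF _ B, of "fst z" T] by (simp add: start)
      ultimately show ?thesis
        using norm_triangle_sub[of "Xs n (fst z) (snd z)" "snd z"] by linarith
    qed
    show "\<exists>d>0. \<forall>n z'. z' \<in> ?S \<and> norm (z - z') < d \<longrightarrow>
        norm (Xs n (fst z) (snd z) - Xs n (fst z') (snd z')) < e" if z: "z \<in> ?S" and e: "0 < e" for z e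
    proof (intro exI[of _ "e / (B + 2)"] conjI allI impI, goal_cases)
      case 1
      then show ?case using e B by simp
    next
      case (2 n z')
      have t: "fst z \<in> {0..T}" "fst z' \<in> {0..T}" using z 2 by auto
      have "norm (Xs n (fst z) (snd z) - Xs n (fst z') (snd z'))
          \<le> norm (Xs n (fst z) (snd z) - Xs n (fst z') (snd z)) + norm (Xs n (fst z') (snd z) - Xs n (fst z') (snd z'))"
        by (rule norm_triangle_ineq[THEN order_trans[rotated]]) simp
      also have "\<dots> \<le> B * norm (z - z') + 4/3 * norm (z - z')"
      proof (rule add_mono)
        have "norm (fst (z - z')) \<le> norm (z - z')" using norm_fst_le[where x = "fst (z - z')" and y = "snd (z - z')"] by (simp only: prod.collapse)
        then show "norm (Xs n (fst z) (snd z) - Xs n (fst z') (snd z)) \<le> B * norm (z - z')"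
          using speed[OF t(2,1), of n "snd z"] mult_left_mono[OF _ B] by fastforce
        have "norm (snd (z - z')) \<le> norm (z - z')" using norm_snd_le[where y = "snd (z - z')" and x = "fst (z - z')"] by (simp only: prod.collapse)
        then show "norm (Xs n (fst z') (snd z) - Xs n (fst z') (snd z')) \<le> 4/3 * norm (z - z')"
          using upper[OF t(2), of n "snd z" "snd z'"] by simp
      qed
      also have "\<dots> \<le> (B + 2) * norm (z - z')"
        by (simp add: algebra_simps)
      also have "\<dots> < e"
        using 2 B by (simp add: field_simps)
      finally show ?case .
    qed
  qed blast
  \<comment> \<open>One representative in the period cell has to serve all indices and times at once, so periodicity is used
    for the map that sends \<open>a\<close> to the whole family of its displacements.\<close>
  have "\<exists>y\<in>cbox 0 L. \<forall>t\<in>{0..T}. \<forall>j. Xs j t a - a = Xs j t y - y" for a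
  proof -
    have "spatially_periodic L (\<lambda>a j t. if t \<in> {0..T} then Xs j t a - a else 0)"
      using periodic unfolding spatially_periodic_def by (auto simp: fun_eq_iff)
    then obtain y where "y \<in> cbox 0 L" and eq: "(\<lambda>j t. if t \<in> {0..T} then Xs j t y - y else 0)
        = (\<lambda>j t. if t \<in> {0..T} then Xs j t a - a else 0)"
      using spatially_periodic_representative[OF _ L] by blast
    moreover have "Xs j t a - a = Xs j t y - y" if "t \<in> {0..T}" for j t
      using fun_cong[OF fun_cong[OF eq, of j], of t] that by simp
    ultimately show ?thesis by blast
  qed
  then have "\<forall>a. \<exists>y. y \<in> cbox 0 L \<and> (\<forall>t\<in>{0..T}. \<forall>j. Xs j t a - a = Xs j t y - y)"
    by blast
  from choice[OF this] obtain \<rho>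
    where \<rho>': "\<forall>a. \<rho> a \<in> cbox 0 L \<and> (\<forall>t\<in>{0..T}. \<forall>j. Xs j t a - a = Xs j t (\<rho> a) - \<rho> a)" ..
  have \<rho>: "\<rho> a \<in> cbox 0 L" for a
    using \<rho>' by blast
  have eq\<rho>: "Xs j t a - a = Xs j t (\<rho> a) - \<rho> a" if "t \<in> {0..T}" for a t j
    using \<rho>' that by blast
  define Y where "Y t a = g (t, \<rho> a) + (a - \<rho> a)" for t a
  have lim_unif: "uniform_limit ({0..T} \<times> UNIV) (\<lambda>j (t, a). Xs (r j) t a) (\<lambda>(t, a). Y t a) sequentially"
  proof (rule uniform_limitI)
    fix e :: real assume e: "0 < e"
    then obtain K where K: "\<And>n z. n \<ge> K \<Longrightarrow> z \<in> ?S \<Longrightarrow> norm (Xs (r n) (fst z) (snd z) - g z) < e"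
      using conv by blast
    have "dist (Xs (r n) t a) (Y t a) < e" if "n \<ge> K" "t \<in> {0..T}" for n t a
    proof -
      have "Xs (r n) t a - Y t a = Xs (r n) t (\<rho> a) - g (t, \<rho> a)"
        using eq\<rho>[OF that(2), of "r n" a] by (simp add: Y_def algebra_simps)
      then show ?thesis
        using K[OF that(1), of "(t, \<rho> a)"] that(2) \<rho> by (simp add: dist_norm)
    qed
    then show "\<forall>\<^sub>F n in sequentially. \<forall>z\<in>{0..T} \<times> UNIV.
        dist (case z of (t, a) \<Rightarrow> Xs (r n) t a) (case z of (t, a) \<Rightarrow> Y t a) < e"
      by (intro eventually_sequentiallyI[of K]) auto
  qed
  have lim: "(\<lambda>j. Xs (r j) t a) \<longlonglongrightarrow> Y t a" if "t \<in> {0..T}" for t a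
    using tendsto_uniform_limitI[OF lim_unif, of "(t, a)"] that by simp
  have Y_upper: "norm (Y t a - Y t b) \<le> 4/3 * norm (a - b)" if t: "t \<in> {0..T}" for t a b
    by (rule LIMSEQ_le_const2[OF tendsto_norm[OF tendsto_diff[OF lim[OF t] lim[OF t]]]])
      (use upper[OF t] in blast)
  have Y_lower: "2/3 * norm (a - b) \<le> norm (Y t a - Y t b)" if t: "t \<in> {0..T}" for t a b
    by (rule LIMSEQ_le_const[OF tendsto_norm[OF tendsto_diff[OF lim[OF t] lim[OF t]]]])
      (use lower[OF t] in blast)
  have Y_bij: "bij (Y t)" if t: "t \<in> {0..T}" for t
  proof (rule bij_if_bilipschitz[OF _ _ Y_lower[OF t]])
    have "(4/3)-lipschitz_on UNIV (Y t)"
      by (rule lipschitz_onI) (use Y_upper[OF t] in \<open>auto simp: dist_norm\<close>)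
    then show "continuous_on UNIV (Y t)"
      by (rule lipschitz_on_continuous_on)
  qed simp
  have Y_periodic: "Y t (a + (L $ i) *\<^sub>R axis i 1) = Y t a + (L $ i) *\<^sub>R axis i 1" if t: "t \<in> {0..T}" for t a i
  proof -
    have "Xs (r j) t (a + (L $ i) *\<^sub>R axis i 1) = Xs (r j) t a + (L $ i) *\<^sub>R axis i 1" for j
      using periodic[OF t, of "r j"] unfolding spatially_periodic_def by (simp add: algebra_simps)
    then have "(\<lambda>j. Xs (r j) t (a + (L $ i) *\<^sub>R axis i 1)) \<longlonglongrightarrow> Y t a + (L $ i) *\<^sub>R axis i 1"
      using tendsto_add[OF lim[OF t, of a] tendsto_const] by simp
    then show ?thesis
      using LIMSEQ_unique lim[OF t] by blast
  qed
  have Y_rigid: "Y t (a + s *\<^sub>R e3) = Y t a + s *\<^sub>R e3" if t: "t \<in> {0..T}" for t a s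
  proof -
    have "(\<lambda>j. \<bar>s\<bar> * c (r j)) \<longlonglongrightarrow> \<bar>s\<bar> * 0"
      using LIMSEQ_subseq_LIMSEQ[OF c r] by (intro tendsto_intros) (simp add: o_def)
    then have "(\<lambda>j. Xs (r j) t (a + s *\<^sub>R e3) - Xs (r j) t a - s *\<^sub>R e3) \<longlonglongrightarrow> 0"
      by (intro Lim_null_comparison[OF always_eventually[OF allI[OF rigid[OF t]]]]) simp
    then have "Y t (a + s *\<^sub>R e3) - Y t a - s *\<^sub>R e3 = 0"
      by (rule LIMSEQ_unique[rotated]) (intro tendsto_intros lim t)
    then show ?thesis by (simp add: algebra_simps)
  qed
  define h :: "real \<Rightarrow> real \<Rightarrow> real^3" where "h a1 a2 = vector [a1, a2, 0]" for a1 a2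
  define lam where "lam a1 a2 t = Y t (h a1 a2) - h a1 a2" for a1 a2 t
  have h_shift: "h (a1 + l) a2 = h a1 a2 + l *\<^sub>R axis 1 1" "h a1 (a2 + l) = h a1 a2 + l *\<^sub>R axis 2 1" for a1 a2 l
    by (simp_all add: h_def vec_eq_iff forall_3 axis_def)
  have h_split: "a = h (a $ 1) (a $ 2) + (a $ 3) *\<^sub>R e3" for a
    by (simp add: h_def vec_eq_iff forall_3 axis_def)
  have "lam (a1 + L $ 1) a2 t = lam a1 a2 t" "lam a1 (a2 + L $ 2) t = lam a1 a2 t" if "t \<in> {0..T}" for t a1 a2
    unfolding lam_def h_shift Y_periodic[OF that] by simp_all
  moreover have "Y t a = a + lam (a $ 1) (a $ 2) t" if "t \<in> {0..T}" for t a
  proof -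
    have "Y t a = Y t (h (a $ 1) (a $ 2)) + (a $ 3) *\<^sub>R e3"
      using Y_rigid[OF that, of "h (a $ 1) (a $ 2)" "a $ 3"] h_split[of a] by simp
    also have "\<dots> = h (a $ 1) (a $ 2) + (a $ 3) *\<^sub>R e3 + lam (a $ 1) (a $ 2) t"
      by (simp add: lam_def)
    finally show ?thesis
      using h_split[of a] by simp
  qed
  ultimately show ?thesis
    using r lim_unif Y_bij by blast
qed

section \<open>Classical solutions of the rotating Euler equations\<close>

lemma gradient_works:
  assumes "p differentiable (at x)"
  shows "(p has_derivative (\<lambda>h. gradient p x \<bullet> h)) (at x)"
proof -
  let ?p' = "frechet_derivative p (at x)"
  have d: "(p has_derivative ?p') (at x)"
    using assms by (simp add: frechet_derivative_works)
  have lin: "linear ?p'"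
    using d by (rule has_derivative_linear)
  have "?p' = (\<lambda>h. gradient p x \<bullet> h)"
  proof
    fix h
    have "?p' h = ?p' (\<Sum>j\<in>UNIV. (h $ j) *\<^sub>R axis j 1)"
      by (simp add: basis_expansion flip: scalar_mult_eq_scaleR)
    then show "?p' h = gradient p x \<bullet> h"
      by (simp add: linear_sum[OF lin] linear_scale[OF lin] gradient_def inner_vec_def mult.commute)
  qed
  with d show ?thesis by simp
qed

text \<open>The bound on \<open>N\<close> controls both the operator norm of the velocity gradient and the vorticity, and
  \<open>ln (5/4) \<le> 5/4 - 1\<close> supplies the smallness of \<open>M1 * T\<close>.\<close>

lemma rotating_euler_gives_flow:
  fixes N :: "real^3^3 \<Rightarrow> real"
  assumes L: "\<forall>i. 0 < L $ i" and N: "admissible_matrix_norm N" and T: "0 < T" and \<Omega>: "0 < \<Omega>"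
    and sol: "rotating_euler_solution L T \<Omega> u0 u"
    and M1: "(SUP t\<in>{0..T}. grad_sup_norm N (u t)) \<le> ereal M1"
    and M1T: "M1 * T \<le> ln (5 / 4)"
    and X: "lagrangian_map T u X"
  shows "\<exists>J p P. periodic_rotating_flow T M1 u J X \<Omega> (time_deriv T u) p P L"
    and "\<And>t x. t \<in> {0..T} \<Longrightarrow> norm (curl (u t) x) \<le> M1"
proof -
  note S = sol[unfolded rotating_euler_solution_def]
  note Na = N[unfolded admissible_matrix_norm_def]
  have NM: "N (jacobian (u t) (at x)) \<le> M1" if t: "t \<in> {0..T}" for t x
  proof -
    have "ereal (N (jacobian (u t) (at x))) \<le> grad_sup_norm N (u t)"
      unfolding grad_sup_norm_def by (rule SUP_upper) simp
    also have "\<dots> \<le> (SUP t\<in>{0..T}. grad_sup_norm N (u t))"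
      by (rule SUP_upper[OF t])
    also note M1
    finally show ?thesis by simp
  qed
  have diff: "u t differentiable (at x)" if "t \<in> {0..T}" for t x
    using S that by blast
  show "norm (curl (u t) x) \<le> M1" if t: "t \<in> {0..T}" for t x
  proof -
    have "norm (curl (u t) x) \<le> N (jacobian (u t) (at x))"
      using Na diff[OF t] by blast
    also have "\<dots> \<le> M1" by (rule NM[OF t])
    finally show ?thesis .
  qed
  define J where "J t x = Blinfun ((*v) (jacobian (u t) (at x)))" for t x
  have J: "blinfun_apply (J t x) = (*v) (jacobian (u t) (at x))" for t x
    unfolding J_def by (rule bounded_linear_Blinfun_apply[OF matrix_vector_mul_bounded_linear])
  have "\<exists>p :: real \<Rightarrow> real^3 \<Rightarrow> real. \<forall>t\<in>{0..T}. spatially_periodic L (p t) \<and>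
      (\<forall>x. p t differentiable (at x) \<and>
        time_deriv T u t x + jacobian (u t) (at x) *v u t x + gradient (p t) x
          + (2 * \<Omega>) *\<^sub>R cross3 e3 (u t x) = 0)"
    using S by (elim conjE)
  then obtain p where p': "\<forall>t\<in>{0..T}. spatially_periodic L (p t) \<and>
      (\<forall>x. p t differentiable (at x) \<and>
        time_deriv T u t x + jacobian (u t) (at x) *v u t x + gradient (p t) x
          + (2 * \<Omega>) *\<^sub>R cross3 e3 (u t x) = 0)" ..
  have p: "spatially_periodic L (p t)" if "t \<in> {0..T}" for t
    using p' that by blast
  have pd: "p t differentiable (at x)" if "t \<in> {0..T}" for t x
    using p' that by blast
  have mom: "time_deriv T u t x + jacobian (u t) (at x) *v u t x + gradient (p t) x
          + (2 * \<Omega>) *\<^sub>R cross3 e3 (u t x) = 0" if "t \<in> {0..T}" for t x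
    using p' that by blast
  have jac_cont: "continuous_on ({0..T} \<times> UNIV) (\<lambda>(t, x). jacobian (u t) (at x))"
    using S by blast
  have "periodic_rotating_flow T M1 u J X \<Omega> (time_deriv T u) p (\<lambda>t. gradient (p t)) L"
  proof
    show "0 < T" "0 < \<Omega>" "\<forall>i. 0 < L $ i" by fact+
    have "0 \<le> N (jacobian (u 0) (at 0))" using Na by blast
    also have "\<dots> \<le> M1" using NM[of 0 0] T by simp
    finally show "0 \<le> M1" .
    have "ln (5 / 4 :: real) \<le> 5 / 4 - 1" by (rule ln_le_minus_one) simp
    then show "M1 * T \<le> 1 / 4" using M1T by simp
    show "continuous_on ({0..T} \<times> UNIV) (\<lambda>(t, x). u t x)"
      and "continuous_on ({0..T} \<times> UNIV) (\<lambda>(t, x). time_deriv T u t x)"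
      using S by blast+
    show "continuous_on ({0..T} \<times> UNIV) (\<lambda>(t, x). J t x)"
    proof (rule continuous_on_blinfun_componentwise)
      fix i :: "real^3"
      have "continuous_on ({0..T} \<times> UNIV) (\<lambda>z. jacobian (u (fst z)) (at (snd z)))"
        using jac_cont by (simp add: case_prod_beta')
      then have "continuous_on ({0..T} \<times> UNIV) (\<lambda>z. jacobian (u (fst z)) (at (snd z)) *v i)"
        unfolding matrix_vector_mult_def by (intro continuous_intros)
      then show "continuous_on ({0..T} \<times> UNIV) (\<lambda>z. blinfun_apply (case z of (t, x) \<Rightarrow> J t x) i)"
        by (simp add: case_prod_beta' J)
    qed
    show "X 0 a = a" for a using X unfolding lagrangian_map_def by blast
    fix t :: real and x :: "real^3" assume t: "t \<in> {0..T}"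
    show "(u t has_derivative blinfun_apply (J t x)) (at x)"
      unfolding J using diff[OF t] jacobian_works by blast
    have "onorm ((*v) (jacobian (u t) (at x))) \<le> N (jacobian (u t) (at x))" using Na by blast
    then show "norm (J t x) \<le> M1"
      using NM[OF t, of x] by (simp add: norm_blinfun.rep_eq J)
    show "((\<lambda>\<tau>. X \<tau> x) has_vector_derivative u t (X t x)) (at t within {0..T})"
      using X t unfolding lagrangian_map_def by blast
    have "(\<lambda>\<tau>. u \<tau> x) differentiable (at t within {0..T})" using S t by blast
    then show "((\<lambda>\<tau>. u \<tau> x) has_vector_derivative time_deriv T u t x) (at t within {0..T})"
      unfolding time_deriv_def by (simp add: vector_derivative_works)
    show "(p t has_derivative (\<lambda>h. gradient (p t) x \<bullet> h)) (at x)"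
      by (rule gradient_works[OF pd[OF t]])
    show "time_deriv T u t x + J t x (u t x) + gradient (p t) x + (2 * \<Omega>) *\<^sub>R cross3 e3 (u t x) = 0"
      using mom[OF t, of x] by (simp add: J)
    have "divergence (u t) x = 0" using S t by blast
    then show "(\<Sum>i\<in>UNIV. J t x (axis i 1) $ i) = 0"
      by (simp add: J divergence_def trace_def matrix_vector_mul_component inner_axis column_def matrix_vector_mult_basis)
    show "spatially_periodic L (u t)" "spatially_periodic L (p t)" using S t p by blast+
  qed
  then show "\<exists>J p P. periodic_rotating_flow T M1 u J X \<Omega> (time_deriv T u) p P L" by blast
qed

text \<open>The Rossby number is an extended real; the bound on the vorticity makes it finite.\<close>

lemma rossby_real:
  assumes T: "0 \<le> T" and \<Omega>: "0 < \<Omega>"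
    and M: "\<And>t x. t \<in> {0..T} \<Longrightarrow> norm (curl (u t) x) \<le> M"
  obtains R where "\<And>t x. t \<in> {0..T} \<Longrightarrow> norm (curl (u t) x) \<le> R" "R \<le> M" "rossby T \<Omega> u = ereal (R / \<Omega>)"
proof -
  define S where "S = (SUP t\<in>{0..T}. sup_norm (curl (u t)))"
  have up: "ereal (norm (curl (u t) x)) \<le> S" if t: "t \<in> {0..T}" for t x
  proof -
    have "ereal (norm (curl (u t) x)) \<le> sup_norm (curl (u t))"
      unfolding sup_norm_def by (rule SUP_upper) simp
    also have "\<dots> \<le> S" unfolding S_def by (rule SUP_upper[OF t])
    finally show ?thesis .
  qed
  have "S \<le> ereal M"
    unfolding S_def sup_norm_def by (intro SUP_least) (simp add: M)
  moreover have "0 \<le> S"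
    by (rule order_trans[OF _ up[of 0 0]]) (use T in auto)
  ultimately obtain R where R: "S = ereal R" "R \<le> M"
    by (cases S) auto
  show thesis
  proof (rule that[of R])
    show "norm (curl (u t) x) \<le> R" if "t \<in> {0..T}" for t x
      using up[OF that, of x] R by simp
    show "rossby T \<Omega> u = ereal (R / \<Omega>)"
      using R \<Omega> by (simp add: rossby_def S_def)
  qed (rule R)
qed

text \<open>The set where two continuous functions differ is open, and a nonempty open set is not null. For all rotation rates
  the initial velocity is thus the same continuous function, the continuous representative of \<open>u0\<close>.\<close>

lemma continuous_eq_if_AE_eq:
  fixes f g :: "'a::euclidean_space \<Rightarrow> 'b::real_normed_vector"
  assumes f: "continuous_on UNIV f" and g: "continuous_on UNIV g"
    and ae: "AE x in lebesgue. f x = g x"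
  shows "f = g"
proof -
  have "open {x. f x \<noteq> g x}"
    using f g open_Collect_neq by blast
  moreover have "negligible {x. f x \<noteq> g x}"
  proof -
    obtain Z where "Z \<in> null_sets lebesgue" "{x. f x \<noteq> g x} \<subseteq> Z"
      using ae by (auto simp: eventually_ae_filter)
    then show ?thesis
      using negligible_iff_null_sets negligible_subset by blast
  qed
  ultimately have "{x. f x \<noteq> g x} = {}"
    using open_not_negligible by blast
  then show ?thesis by auto
qed

lemma partial3_eq:
  assumes "(f has_derivative f') (at x)"
  shows "has_partial3 f x" and "partial3 f x = f' e3"
proof -
  have line: "((\<lambda>h. x + h *\<^sub>R e3) has_derivative (\<lambda>h. h *\<^sub>R e3)) (at 0)"
    by (auto intro!: derivative_eq_intros)
  have lin: "linear f'"
    using assms has_derivative_linear by blast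
  have "((\<lambda>h. f (x + h *\<^sub>R e3)) has_derivative (\<lambda>h. f' (h *\<^sub>R e3))) (at 0)"
    by (rule has_derivative_compose[OF line]) (use assms in simp)
  then have d: "((\<lambda>h. f (x + h *\<^sub>R e3)) has_vector_derivative f' e3) (at 0)"
    by (simp add: has_vector_derivative_def linear_scale[OF lin])
  show "has_partial3 f x"
    unfolding has_partial3_def using d
    by (auto simp: has_vector_derivative_def differentiable_def)
  show "partial3 f x = f' e3"
    unfolding partial3_def using d by (rule vector_derivative_at)
qed

section \<open>Displacements at high rotation rate\<close>

lemma displacement_estimates:
  fixes N :: "real^3^3 \<Rightarrow> real"
  assumes L: "\<forall>i. 0 < L $ i" and N: "admissible_matrix_norm N" and T: "0 < T" and \<Omega>: "0 < \<Omega>"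
    and sol: "rotating_euler_solution L T \<Omega> u0 u"
    and M1: "(SUP t\<in>{0..T}. grad_sup_norm N (u t)) \<le> ereal M1"
    and M1T: "M1 * T \<le> ln (5 / 4)"
    and X: "lagrangian_map T u X"
  shows "(\<forall>t\<in>{0..T}. bij (X t) \<and>
      (\<forall>x. has_partial3 (inverse_displacement X t) x) \<and>
      (\<forall>a. has_partial3 (direct_displacement X t) a) \<and>
      sup_norm (partial3 (inverse_displacement X t)) \<le> 14 * rossby T \<Omega> u \<and>
      sup_norm (partial3 (direct_displacement X t)) \<le> 9 * rossby T \<Omega> u) \<and>
    rossby T \<Omega> u \<le> ereal (M1 / \<Omega>)"
proof -
  note E = L N T \<Omega> sol M1 M1T X
  obtain J p P where "periodic_rotating_flow T M1 u J X \<Omega> (time_deriv T u) p P L"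
    using rotating_euler_gives_flow(1)[OF E] by blast
  then interpret periodic_rotating_flow T M1 u J X \<Omega> "time_deriv T u" p P L .
  obtain R where R: "\<And>t x. t \<in> {0..T} \<Longrightarrow> norm (curl (u t) x) \<le> R" and RM: "R \<le> M1"
    and rossby: "rossby T \<Omega> u = ereal (R / \<Omega>)"
    using rossby_real[where u = u, OF less_imp_le[OF T] \<Omega> rotating_euler_gives_flow(2)[OF E]]
    by blast
  have R0: "0 \<le> R / \<Omega>"
    using order_trans[OF norm_ge_zero R[of 0 0]] T_pos \<Omega> by simp
  have direct: "(direct_displacement X t has_derivative (\<lambda>h. deformation t a h - h)) (at a)"
    if t: "t \<in> {0..T}" for t a
    unfolding direct_displacement_def[abs_def]
    by (intro has_derivative_diff X_deriv[OF t] has_derivative_ident)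
  have inverse: "\<exists>D. (inverse_displacement X t has_derivative D) (at x) \<and> norm (D e3) \<le> 7/4 * (R / \<Omega>)"
    if t: "t \<in> {0..T}" for t x
  proof -
    obtain B where B: "(inv (X t) has_derivative B) (at x)"
      and BF: "\<And>h. B (deformation t (inv (X t) x) h) = h"
      and bound: "\<And>h. norm (B h) \<le> 3/2 * norm h"
      using inverse_flow_deriv[OF t] by blast
    have "(inverse_displacement X t has_derivative (\<lambda>h. B h - h)) (at x)"
      unfolding inverse_displacement_def[abs_def]
      by (intro has_derivative_diff B has_derivative_ident)
    with inverse_axial_bound[OF t R BF bound] show ?thesis by blast
  qed
  have main: "bij (X t) \<and>
          (\<forall>x. has_partial3 (inverse_displacement X t) x) \<and>
          (\<forall>a. has_partial3 (direct_displacement X t) a) \<and>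
          sup_norm (partial3 (inverse_displacement X t)) \<le> 14 * rossby T \<Omega> u \<and>
          sup_norm (partial3 (direct_displacement X t)) \<le> 9 * rossby T \<Omega> u"
    if t: "t \<in> {0..T}" for t
  proof (intro conjI allI)
    show "bij (X t)" by (rule flow_bij[OF t])
    show "has_partial3 (inverse_displacement X t) x" for x
      using inverse[OF t] partial3_eq(1) by blast
    show "has_partial3 (direct_displacement X t) a" for a
      by (rule partial3_eq(1)[OF direct[OF t]])
    have "norm (partial3 (inverse_displacement X t) x) \<le> 14 * (R / \<Omega>)" for x
      using inverse[OF t, of x] partial3_eq(2) R0 by fastforce
    then show "sup_norm (partial3 (inverse_displacement X t)) \<le> 14 * rossby T \<Omega> u"
      unfolding sup_norm_def rossby by (intro SUP_least) (simp add: numeral_eq_ereal)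
    have "norm (partial3 (direct_displacement X t) a) \<le> 9 * (R / \<Omega>)" for a
      using axial_deformation_bound[OF t R, of a] R0 by (simp add: partial3_eq(2)[OF direct[OF t]])
    then show "sup_norm (partial3 (direct_displacement X t)) \<le> 9 * rossby T \<Omega> u"
      unfolding sup_norm_def rossby by (intro SUP_least) (simp add: numeral_eq_ereal)
  qed
  have "rossby T \<Omega> u \<le> ereal (M1 / \<Omega>)"
    using RM \<Omega> by (simp add: rossby divide_right_mono)
  with main show ?thesis by blast
qed

theorem theorem6:
  fixes L :: "real^3" and s T M1 :: real
    and N :: "real^3^3 \<Rightarrow> real"
    and u0 :: "real^3 \<Rightarrow> real^3"
    and u X :: "real \<Rightarrow> real \<Rightarrow> real^3 \<Rightarrow> real^3"
  assumes "\<forall>i. 0 < L $ i"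
    and "admissible_matrix_norm N"
    and "5 / 2 < s" and "u0 \<in> sobolev_div_free L s"
    and "0 < T"
    and "\<And>\<Omega>. 0 < \<Omega> \<Longrightarrow> rotating_euler_solution L T \<Omega> u0 (u \<Omega>)"
    and "\<And>\<Omega>. 0 < \<Omega> \<Longrightarrow> (SUP t\<in>{0..T}. grad_sup_norm N (u \<Omega> t)) \<le> ereal M1"
    and "M1 * T \<le> ln (5 / 4)"
    and "\<And>\<Omega>. 0 < \<Omega> \<Longrightarrow> lagrangian_map T (u \<Omega>) (X \<Omega>)"
  shows
    "(\<forall>\<Omega>. 0 < \<Omega> \<longrightarrow> 4 * M1 \<le> \<Omega> \<longrightarrow>
       (\<forall>t\<in>{0..T}.
          bij (X \<Omega> t) \<and>
          (\<forall>x. has_partial3 (inverse_displacement (X \<Omega>) t) x) \<and>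
          (\<forall>a. has_partial3 (direct_displacement (X \<Omega>) t) a) \<and>
          sup_norm (partial3 (inverse_displacement (X \<Omega>) t)) \<le> 14 * rossby T \<Omega> (u \<Omega>) \<and>
          sup_norm (partial3 (direct_displacement (X \<Omega>) t)) \<le> 9 * rossby T \<Omega> (u \<Omega>)) \<and>
       rossby T \<Omega> (u \<Omega>) \<le> ereal (M1 / \<Omega>))
     \<and>
     (\<forall>w :: nat \<Rightarrow> real. (\<forall>j. 0 < w j) \<longrightarrow> filterlim w at_top sequentially \<longrightarrow>
       (\<exists>(r :: nat \<Rightarrow> nat) (Y :: real \<Rightarrow> real^3 \<Rightarrow> real^3) (lam :: real \<Rightarrow> real \<Rightarrow> real \<Rightarrow> real^3).
          strict_mono r \<and>
          uniform_limit ({0..T} \<times> UNIV) (\<lambda>j (t, a). X (w (r j)) t a) (\<lambda>(t, a). Y t a) sequentially \<and>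
          (\<forall>t\<in>{0..T}. bij (Y t)) \<and>
          (\<forall>t\<in>{0..T}. \<forall>a1 a2. lam (a1 + L $ 1) a2 t = lam a1 a2 t \<and> lam a1 (a2 + L $ 2) t = lam a1 a2 t) \<and>
          (\<forall>t\<in>{0..T}. \<forall>a. Y t a = a + lam (a $ 1) (a $ 2) t)))"
proof (rule conjI, goal_cases)
  case 1
  show ?case
    using displacement_estimates[OF assms(1,2,5) _ assms(6) assms(7) assms(8) assms(9)] by blast
next
  case 2
  show ?case
  proof (intro allI impI, goal_cases)
    case (1 w)
    then have w: "0 < w j" for j by simp
    note E = assms(1,2,5) w assms(6)[OF w] assms(7)[OF w] assms(8) assms(9)[OF w]
    have flow: "\<exists>J p P. periodic_rotating_flow T M1 (u (w j)) J (X (w j)) (w j) (time_deriv T (u (w j))) p P L" for j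
      by (rule rotating_euler_gives_flow(1)[OF E])
    have curl_bound: "norm (curl (u (w j) t) x) \<le> M1" if "t \<in> {0..T}" for j t x
      by (rule rotating_euler_gives_flow(2)[OF E that])
    have cont0: "continuous_on UNIV (u (w j) 0)" for j
    proof -
      obtain J p P where "periodic_rotating_flow T M1 (u (w j)) J (X (w j)) (w j) (time_deriv T (u (w j))) p P L"
        using flow by blast
      then interpret periodic_rotating_flow T M1 "u (w j)" J "X (w j)" "w j" "time_deriv T (u (w j))" p P L .
      show ?thesis
        using continuous_on_v[of UNIV "\<lambda>_. 0" "\<lambda>x. x"] T_pos by simp
    qed
    have ae: "AE x in lebesgue. u (w j) 0 x = u0 x" for j
      using assms(6)[OF w, of j] unfolding rotating_euler_solution_def by (elim conjE)
    have same: "u (w j) 0 = u (w 0) 0" for j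
    proof (rule continuous_eq_if_AE_eq[OF cont0 cont0])
      show "AE x in lebesgue. u (w j) 0 x = u (w 0) 0 x"
        using ae[of j] ae[of 0] by eventually_elim simp
    qed
    have per0: "spatially_periodic L (u (w 0) 0)"
      using assms(6)[OF w, of 0] assms(5) unfolding rotating_euler_solution_def by simp
    have "compact (u (w 0) 0 ` cbox 0 L)"
      by (intro compact_continuous_image continuous_on_subset[OF cont0]) auto
    then obtain V0 where V0': "\<And>y. y \<in> cbox 0 L \<Longrightarrow> norm (u (w 0) 0 y) \<le> V0"
      by (meson bounded_iff compact_imp_bounded imageI)
    have V0: "norm (u (w j) 0 x) \<le> V0" for j x
    proof -
      obtain y where "y \<in> cbox 0 L" "u (w 0) 0 y = u (w 0) 0 x"
        by (rule spatially_periodic_representative[OF per0 assms(1)])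
      with V0'[of y] show ?thesis by (simp add: same[of j])
    qed
    show ?case
    proof (rule subsequential_limit_of_flows[where B = "V0 + 1 + M1 * norm L" and c = "\<lambda>j. 7/6 * (M1 / w j)"])
      show "\<forall>i. 0 < L $ i" "0 < T" by fact+
      show "(\<lambda>j. 7/6 * (M1 / w j)) \<longlonglongrightarrow> 0"
      proof -
        have "(\<lambda>j. M1 / w j) \<longlonglongrightarrow> 0"
          by (rule tendsto_divide_0[OF tendsto_const filterlim_at_top_imp_at_infinity[OF 1(2)]])
        from tendsto_mult[OF tendsto_const this, of "7/6"] show ?thesis by simp
      qed
      fix j
      obtain J p P where "periodic_rotating_flow T M1 (u (w j)) J (X (w j)) (w j) (time_deriv T (u (w j))) p P L"
        using flow by blast
      then interpret periodic_rotating_flow T M1 "u (w j)" J "X (w j)" "w j" "time_deriv T (u (w j))" p P L .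
      show "X (w j) 0 a = a" for a by (rule X_start)
      fix t assume t: "t \<in> {0..T}"
      show "norm (X (w j) t a - X (w j) t b) \<le> 4/3 * norm (a - b)" for a b
        by (rule flow_upper[OF t])
      show "2/3 * norm (a - b) \<le> norm (X (w j) t a - X (w j) t b)" for a b
        by (rule flow_lower[OF t])
      show "norm (X (w j) \<tau> a - X (w j) t a) \<le> (V0 + 1 + M1 * norm L) * \<bar>\<tau> - t\<bar>" if "\<tau> \<in> {0..T}" for \<tau> a
        by (rule X_time_lipschitz[OF t that V0])
      show "spatially_periodic L (\<lambda>a. X (w j) t a - a)"
        by (rule displacement_periodic[OF t])
      show "norm (X (w j) t (a + s *\<^sub>R e3) - X (w j) t a - s *\<^sub>R e3) \<le> \<bar>s\<bar> * (7/6 * (M1 / w j))" for a s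
        by (rule axial_rigidity[OF t curl_bound])
    qed
  qed
qed

end
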